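(* Let $\mathcal{S}=(S,+,\cdot)$ be an additively idempotent semiring for which there exist $m,h\ge 1$ such that the multiplicative reduct $(S,\cdot)$ satisfies the identities $\mathbf v_{n,m}^{(h)}\approx(\mathbf v_{n,m}^{(h)})^2$ for all $n\ge 2$. If the additively idempotent semiring $(B_2^1,+_{\mathrm{nat}},\cdot)$ satisfies all identities of $\mathcal{S}$, then $\mathcal{S}$ admits no finite identity basis.
   Context: An additively idempotent semiring is an algebra $(S,+,\cdot)$ of type $(2,2)$ such that $(S,+)$ is a commutative idempotent semigroup, $(S,\cdot)$ is a semigroup (the multiplicative reduct), and the identities $x(y+z)\approx xy+xz$ and $(y+z)x\approx yx+zx$ hold. A set $\Sigma$ of identities valid in an algebra $\mathcal A$ is an identity basis for $\mathcal A$ if all identities holding in $\mathcal A$ follow from $\Sigma$. Identities of additively idempotent semirings are in the signature $\{+,\cdot\}$. $B_2^1$ consists of the six matrices $\begin{pmatrix}0&0\\0&0\end{pmatrix},\begin{pmatrix}1&0\\0&0\end{pmatrix},\begin{pmatrix}0&1\\0&0\end{pmatrix},\begin{pmatrix}0&0\\1&0\end{pmatrix},\begin{pmatrix}0&0\\0&1\end{pmatrix},\begin{pmatrix}1&0\\0&1\end{pmatrix}$ with the usual matrix multiplication; it is an inverse semigroup under transposition as inversion. Here $x+_{\mathrm{nat}}y$ is the infimum of $x,y$ in the natural partial order $x\le_{\mathrm{nat}}y\iff x=xx^{-1}y$; equivalently, $+_{\mathrm{nat}}$ is the entrywise product of matrices. The words $\mathbf v_{n,m}^{(h)}$ ($n,m,h\ge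 1$) are words over the alphabet $X_{2n}^{(h)}=\{x_{i_1i_2\cdots i_h}\mid i_1,\dots,i_h\in\{1,\dots,2n\}\}$, defined by induction on $h$: \[ \mathbf v_{n,m}^{(1)}:=x_1x_2\cdots x_{2n}\,\bigl(x_nx_{n-1}\cdots x_1\cdot x_{n+1}x_{n+2}\cdots x_{2n}\bigr)^{2m-1}, \] and for $h>1$, letting $\mathbf v_{n,m,j}^{(h-1)}$ ($j=1,\dots,2n$) be the word obtained from $\mathbf v_{n,m}^{(h-1)}$ by replacing each variable $x_{i_1\cdots i_{h-1}}$ with $x_{i_1\cdots i_{h-1}j}$, \[ \mathbf v_{n,m}^{(h)}:=\mathbf v_{n,m,1}^{(h-1)}\cdots\mathbf v_{n,m,2n}^{(h-1)}\bigl(\mathbf v_{n,m,n}^{(h-1)}\mathbf v_{n,m,n-1}^{(h-1)}\cdots\mathbf v_{n,m,1}^{(h-1)}\cdot\mathbf v_{n,m,n+1}^{(h-1)}\cdots\mathbf v_{n,m,2n}^{(h-1)}\bigr)^{2m-1}. \] *)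

theory Defs
  imports "HOL-Analysis.Cartesian_Space"
begin

section \<open>Additively idempotent semirings\<close>

locale ai_semiring =
  fixes S :: "'a set"
    and add :: "'a \<Rightarrow> 'a \<Rightarrow> 'a"
    and mul :: "'a \<Rightarrow> 'a \<Rightarrow> 'a"
  assumes nonempty: "S \<noteq> {}"
    and add_closed: "\<lbrakk>x \<in> S; y \<in> S\<rbrakk> \<Longrightarrow> add x y \<in> S"
    and mul_closed: "\<lbrakk>x \<in> S; y \<in> S\<rbrakk> \<Longrightarrow> mul x y \<in> S"
    and add_assoc: "\<lbrakk>x \<in> S; y \<in> S; z \<in> S\<rbrakk> \<Longrightarrow> add (add x y) z = add x (add y z)"
    and add_comm: "\<lbrakk>x \<in> S; y \<in> S\<rbrakk> \<Longrightarrow> add x y = add y x"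
    and add_idem: "x \<in> S \<Longrightarrow> add x x = x"
    and mul_assoc: "\<lbrakk>x \<in> S; y \<in> S; z \<in> S\<rbrakk> \<Longrightarrow> mul (mul x y) z = mul x (mul y z)"
    and distrib_left: "\<lbrakk>x \<in> S; y \<in> S; z \<in> S\<rbrakk> \<Longrightarrow> mul x (add y z) = add (mul x y) (mul x z)"
    and distrib_right: "\<lbrakk>x \<in> S; y \<in> S; z \<in> S\<rbrakk> \<Longrightarrow> mul (add y z) x = add (mul y x) (mul z x)"

section \<open>Identities of type (2,2) and identity bases\<close>

datatype trm = Var nat | Add trm trm | Mul trm trm

type_synonym identity = "trm \<times> trm"

primrec eval :: "('a \<Rightarrow> 'a \<Rightarrow> 'a) \<Rightarrow> ('a \<Rightarrow> 'a \<Rightarrow> 'a) \<Rightarrow> (nat \<Rightarrow> 'a) \<Rightarrow> trm \<Rightarrow> 'a" where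
  "eval add mul \<phi> (Var x) = \<phi> x"
| "eval add mul \<phi> (Add s t) = add (eval add mul \<phi> s) (eval add mul \<phi> t)"
| "eval add mul \<phi> (Mul s t) = mul (eval add mul \<phi> s) (eval add mul \<phi> t)"

definition satisfies ::
  "'a set \<Rightarrow> ('a \<Rightarrow> 'a \<Rightarrow> 'a) \<Rightarrow> ('a \<Rightarrow> 'a \<Rightarrow> 'a) \<Rightarrow> identity \<Rightarrow> bool" where
  "satisfies S add mul e \<longleftrightarrow>
     (\<forall>\<phi>. (\<forall>x. \<phi> x \<in> S) \<longrightarrow> eval add mul \<phi> (fst e) = eval add mul \<phi> (snd e))"

abbreviation subst :: "(nat \<Rightarrow> trm) \<Rightarrow> trm \<Rightarrow> trm" where
  "subst \<equiv> eval Add Mul"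

text \<open>Consequence in the class of all algebras of type (2,2), by the rules of equational logic;
  the semiring axioms are not built in. See \<open>follows_sound\<close> and \<open>follows_complete\<close>
  for the equivalence with semantic consequence.\<close>

inductive follows :: "identity set \<Rightarrow> trm \<Rightarrow> trm \<Rightarrow> bool" for \<Sigma> :: "identity set" where
  inst: "(s, t) \<in> \<Sigma> \<Longrightarrow> follows \<Sigma> (subst \<sigma> s) (subst \<sigma> t)"
| refl: "follows \<Sigma> s s"
| sym: "follows \<Sigma> s t \<Longrightarrow> follows \<Sigma> t s"
| trans: "\<lbrakk>follows \<Sigma> s t; follows \<Sigma> t u\<rbrakk> \<Longrightarrow> follows \<Sigma> s u"
| cong_Add: "\<lbrakk>follows \<Sigma> s s'; follows \<Sigma> t t'\<rbrakk> \<Longrightarrow> follows \<Sigma> (Add s t) (Add s' t')"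
| cong_Mul: "\<lbrakk>follows \<Sigma> s s'; follows \<Sigma> t t'\<rbrakk> \<Longrightarrow> follows \<Sigma> (Mul s t) (Mul s' t')"

definition identity_basis ::
  "'a set \<Rightarrow> ('a \<Rightarrow> 'a \<Rightarrow> 'a) \<Rightarrow> ('a \<Rightarrow> 'a \<Rightarrow> 'a) \<Rightarrow> identity set \<Rightarrow> bool" where
  "identity_basis S add mul \<Sigma> \<longleftrightarrow>
     (\<forall>e \<in> \<Sigma>. satisfies S add mul e) \<and>
     (\<forall>s t. satisfies S add mul (s, t) \<longrightarrow> follows \<Sigma> s t)"

lemma eval_closed:
  assumes "\<And>x y. \<lbrakk>x \<in> S; y \<in> S\<rbrakk> \<Longrightarrow> add x y \<in> S"
    and "\<And>x y. \<lbrakk>x \<in> S; y \<in> S\<rbrakk> \<Longrightarrow> mul x y \<in> S"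
    and "\<And>x. \<phi> x \<in> S"
  shows "eval add mul \<phi> t \<in> S"
  by (induction t) (use assms in auto)

lemma eval_subst:
  "eval add mul \<phi> (subst \<sigma> t) = eval add mul (\<lambda>x. eval add mul \<phi> (\<sigma> x)) t"
  by (induction t) auto

theorem follows_sound:
  assumes "follows \<Sigma> s t"
    and closed: "\<And>x y. \<lbrakk>x \<in> S; y \<in> S\<rbrakk> \<Longrightarrow> add x y \<in> S"
      "\<And>x y. \<lbrakk>x \<in> S; y \<in> S\<rbrakk> \<Longrightarrow> mul x y \<in> S"
    and \<Sigma>: "\<forall>e \<in> \<Sigma>. satisfies S add mul e"
  shows "satisfies S add mul (s, t)"
  using assms(1)
proof induction
  case (inst s t \<sigma>)
  have "eval add mul \<phi> (subst \<sigma> s) = eval add mul \<phi> (subst \<sigma> t)" if "\<forall>x. \<phi> x \<in> S" for \<phi>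
    unfolding eval_subst using \<Sigma> inst that eval_closed[of S add mul \<phi>, OF closed]
    by (fastforce simp: satisfies_def)
  then show ?case by (simp add: satisfies_def)
qed (auto simp: satisfies_def)

theorem follows_complete:
  assumes "\<And>(S :: trm set set) add mul.
      \<lbrakk>S \<noteq> {}; \<And>x y. \<lbrakk>x \<in> S; y \<in> S\<rbrakk> \<Longrightarrow> add x y \<in> S;
       \<And>x y. \<lbrakk>x \<in> S; y \<in> S\<rbrakk> \<Longrightarrow> mul x y \<in> S; \<forall>e \<in> \<Sigma>. satisfies S add mul e\<rbrakk>
      \<Longrightarrow> satisfies S add mul (s, t)"
  shows "follows \<Sigma> s t"
proof -
  define cls where "cls u = {v. follows \<Sigma> u v}" for u
  define rep where "rep X = (SOME u. cls u = X)" for X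
  define pl where "pl X Y = cls (Add (rep X) (rep Y))" for X Y
  define ti where "ti X Y = cls (Mul (rep X) (rep Y))" for X Y
  have cls_eq: "cls u = cls v \<longleftrightarrow> follows \<Sigma> u v" for u v
    unfolding cls_def by (blast intro: follows.refl follows.sym follows.trans)
  have "cls (rep (cls u)) = cls u" for u
    unfolding rep_def by (rule someI[where x = u]) (rule HOL.refl)
  then have rep: "follows \<Sigma> (rep (cls u)) u" for u
    using cls_eq by blast
  have pl: "pl (cls u) (cls v) = cls (Add u v)" for u v
    unfolding pl_def cls_eq by (intro follows.cong_Add rep)
  have ti: "ti (cls u) (cls v) = cls (Mul u v)" for u v
    unfolding ti_def cls_eq by (intro follows.cong_Mul rep)
  have ev: "eval pl ti (\<lambda>x. cls (\<sigma> x)) u = cls (subst \<sigma> u)" for \<sigma> u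
    by (induction u) (auto simp: pl ti)
  have "satisfies (range cls) pl ti e" if "e \<in> \<Sigma>" for e
    unfolding satisfies_def
  proof (intro allI impI)
    fix \<phi> :: "nat \<Rightarrow> trm set" assume "\<forall>x. \<phi> x \<in> range cls"
    then have "\<forall>x. \<exists>u. \<phi> x = cls u" by auto
    then obtain \<sigma> where "\<phi> = (\<lambda>x. cls (\<sigma> x))" by metis
    with that show "eval pl ti \<phi> (fst e) = eval pl ti \<phi> (snd e)"
      by (cases e) (auto simp: ev cls_eq intro: follows.inst)
  qed
  then have "satisfies (range cls) pl ti (s, t)"
    by (intro assms) (auto simp: pl_def ti_def)
  then have "eval pl ti (\<lambda>x. cls (Var x)) s = eval pl ti (\<lambda>x. cls (Var x)) t"
    by (simp add: satisfies_def)
  moreover have "subst Var u = u" for u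
    by (induction u) auto
  ultimately show ?thesis
    by (simp add: ev cls_eq)
qed

section \<open>Semigroup identities and the words $v_{n,m}^{(h)}$\<close>

text \<open>A word is a nonempty list of variables; the value on the empty list is unspecified.\<close>

fun word_eval :: "('a \<Rightarrow> 'a \<Rightarrow> 'a) \<Rightarrow> ('v \<Rightarrow> 'a) \<Rightarrow> 'v list \<Rightarrow> 'a" where
  "word_eval mul \<phi> [] = undefined"
| "word_eval mul \<phi> [x] = \<phi> x"
| "word_eval mul \<phi> (x # y # w) = mul (\<phi> x) (word_eval mul \<phi> (y # w))"

definition semigroup_satisfies ::
  "'a set \<Rightarrow> ('a \<Rightarrow> 'a \<Rightarrow> 'a) \<Rightarrow> 'v list \<Rightarrow> 'v list \<Rightarrow> bool" where
  "semigroup_satisfies S mul u v \<longleftrightarrow>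
     (\<forall>\<phi>. (\<forall>x. \<phi> x \<in> S) \<longrightarrow> word_eval mul \<phi> u = word_eval mul \<phi> v)"

definition word_pow :: "'v list \<Rightarrow> nat \<Rightarrow> 'v list" where
  "word_pow w k = concat (replicate k w)"

text \<open>\<open>v_pattern n m w\<close> is
  $w_1 \cdots w_{2n} (w_n \cdots w_1 \cdot w_{n+1} \cdots w_{2n})^{2m-1}$.\<close>

definition v_pattern :: "nat \<Rightarrow> nat \<Rightarrow> (nat \<Rightarrow> 'v list) \<Rightarrow> 'v list" where
  "v_pattern n m w =
     concat (map w [1..<2*n+1]) @
     word_pow (concat (map w (rev [1..<n+1])) @ concat (map w [n+1..<2*n+1])) (2*m - 1)"

text \<open>The variable $x_{i_1 \ldots i_h}$ is represented by the list of its indices.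
  Only $n, m, h \ge 1$ is meaningful; the value at $h = 0$ is a dummy.\<close>

fun v_word :: "nat \<Rightarrow> nat \<Rightarrow> nat \<Rightarrow> nat list list" where
  "v_word n m 0 = []"
| "v_word n m (Suc 0) = v_pattern n m (\<lambda>j. [[j]])"
| "v_word n m (Suc (Suc h)) =
     v_pattern n m (\<lambda>j. map (\<lambda>is. is @ [j]) (v_word n m (Suc h)))"

section \<open>The semiring $(B_2^1, +_{nat}, \cdot)$\<close>

definition B21 :: "(int^2^2) set" where
  "B21 = {vector [vector [0, 0], vector [0, 0]],
          vector [vector [1, 0], vector [0, 0]],
          vector [vector [0, 1], vector [0, 0]],
          vector [vector [0, 0], vector [1, 0]],
          vector [vector [0, 0], vector [0, 1]],
          vector [vector [1, 0], vector [0, 1]]}"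

definition nat_le :: "int^2^2 \<Rightarrow> int^2^2 \<Rightarrow> bool" where
  "nat_le x y \<longleftrightarrow> x = x ** transpose x ** y"

definition nat_add :: "int^2^2 \<Rightarrow> int^2^2 \<Rightarrow> int^2^2" where
  "nat_add x y =
     (THE z. z \<in> B21 \<and> nat_le z x \<and> nat_le z y \<and>
        (\<forall>w \<in> B21. nat_le w x \<and> nat_le w y \<longrightarrow> nat_le w z))"

lemma nat_le_B21:
  assumes "x \<in> B21" "y \<in> B21"
  shows "nat_le x y \<longleftrightarrow> (\<forall>i j. x $ i $ j \<noteq> 0 \<longrightarrow> x $ i $ j = y $ i $ j)"
  using assms unfolding B21_def nat_le_def
  by (elim insertE emptyE)
     (simp_all add: vec_eq_iff forall_2 sum_2 matrix_matrix_mult_def transpose_def)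

lemma hadamard_B21:
  assumes "x \<in> B21" "y \<in> B21"
  shows "(\<chi> i j. x $ i $ j * y $ i $ j) \<in> B21"
  using assms unfolding B21_def
  by (elim insertE emptyE) (simp_all add: vec_eq_iff forall_2)

theorem nat_add_eq_entrywise:
  assumes x: "x \<in> B21" and y: "y \<in> B21"
  shows "nat_add x y = (\<chi> i j. x $ i $ j * y $ i $ j)"
proof -
  let ?z = "\<chi> i j. x $ i $ j * y $ i $ j"
  have z: "?z \<in> B21" using assms by (rule hadamard_B21)
  have e01: "u $ i $ j = 0 \<or> u $ i $ j = 1" if "u \<in> B21" for u i j
  proof -
    have "\<forall>i j. u $ i $ j = 0 \<or> u $ i $ j = 1"
      using that unfolding B21_def by (elim insertE emptyE) (simp_all add: forall_2)
    then show ?thesis by blast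
  qed
  have anti: "u = v" if "u \<in> B21" "v \<in> B21" "nat_le u v" "nat_le v u" for u v
    using that by (simp add: nat_le_B21 vec_eq_iff) metis
  have lb: "nat_le ?z x" "nat_le ?z y"
    using e01[OF x] e01[OF y] by (auto simp: nat_le_B21 x y z)
  have glb: "nat_le w ?z" if "w \<in> B21" "nat_le w x" "nat_le w y" for w
    using that e01[OF that(1)] by (auto simp: nat_le_B21 x y z) (metis mult_1)
  show ?thesis
    unfolding nat_add_def
    by (rule the_equality) (use z lb glb anti in blast)+
qed

lemma ai_semiring_B21: "ai_semiring B21 nat_add (**)"
proof -
  have cl: "x ** y \<in> B21" if "x \<in> B21" "y \<in> B21" for x y
    using that unfolding B21_def
    by (elim insertE emptyE) (simp_all add: vec_eq_iff forall_2 sum_2 matrix_matrix_mult_def)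
  have dl: "x ** (\<chi> i j. y $ i $ j * z $ i $ j) =
      (\<chi> i j. (x ** y) $ i $ j * (x ** z) $ i $ j)"
    and dr: "(\<chi> i j. y $ i $ j * z $ i $ j) ** x =
      (\<chi> i j. (y ** x) $ i $ j * (z ** x) $ i $ j)"
    if "x \<in> B21" for x y z
    using that unfolding B21_def
    by (elim insertE emptyE;
        simp add: vec_eq_iff forall_2 sum_2 matrix_matrix_mult_def)+
  have idem: "(\<chi> i j. x $ i $ j * x $ i $ j) = x" if "x \<in> B21" for x
    using that unfolding B21_def by (elim insertE emptyE) (simp_all add: vec_eq_iff forall_2)
  have ne: "B21 \<noteq> {}"
    by (simp add: B21_def)
  show ?thesis
    by unfold_locales
       (simp_all add: ne nat_add_eq_entrywise hadamard_B21 cl dl dr idem matrix_mul_assoc mult_ac)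
qed

end

theory Submission
  imports Defs
begin

text \<open>For every \<open>k\<close> there is a semiring that satisfies all identities of
  \<open>(B\<^sub>2\<^sup>1, +\<^sub>n\<^sub>a\<^sub>t, \<cdot>)\<close> in at most \<open>k\<close> variables and in which
  \<open>v \<approx> v\<^sup>2\<close> fails for $v = \mathbf v_{n,m}^{(h)}$ with \<open>n > k\<close>; soundness of equational
  logic then excludes every basis in finitely many variables. The semiring consists of partial
  injections under composition and intersection, acting on a graph in which $v$ labels a walk
  between two distinct vertices \<open>\<alpha>\<close> and \<open>\<beta>\<close>. For \<open>h = 1\<close> the walk reads
  \<open>x\<^sub>1, \<dots>, x\<^sub>n\<close> from \<open>\<alpha>\<close> to a vertex \<open>\<nu>\<close>, crosses from \<open>\<nu>\<close> to \<open>\<beta>\<close> and then repeats a cycle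
  that reads \<open>x\<^sub>n, \<dots>, x\<^sub>1\<close> from \<open>\<beta>\<close> back to \<open>\<nu>\<close> along new edges; for larger \<open>h\<close> each edge is
  replaced by a copy of the previous graph.

  A two-colouring of the vertices under which a partial injection \<open>r\<close> either preserves colours or
  always moves from one fixed colour to the other turns \<open>r\<close> into an element of
  \<open>B\<^sub>2\<^sup>1\<close>. If such colourings, admissible for finitely many maps at once, separate the points
  and the domains of these maps, then the maps satisfy the identities of \<open>B\<^sub>2\<^sup>1\<close>. For fewer
  than \<open>n\<close> maps they do, because every map of rank at least two lives inside the copies of a
  single edge label, so that one of \<open>x\<^sub>1, \<dots>, x\<^sub>n\<close> is left unused, and cutting the graph there separates
  \<open>\<alpha>\<close> from \<open>\<beta>\<close>.\<close>

section \<open>The graphs and their partial injections\<close>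

datatype vertex = V nat | In nat nat nat vertex

type_synonym rel = "(vertex \<times> vertex) set"

definition adm :: "(vertex \<Rightarrow> bool) \<Rightarrow> rel \<Rightarrow> bool" where
  "adm f r \<longleftrightarrow> (\<forall>(p, q) \<in> r. f p = f q) \<or> (\<exists>c. \<forall>(p, q) \<in> r. f p = c \<and> f q = (\<not> c))"

definition sep :: "vertex set \<Rightarrow> rel set \<Rightarrow> bool" where
  "sep X G \<longleftrightarrow> (\<forall>p\<in>X. \<forall>q\<in>X. p \<noteq> q \<longrightarrow> (\<exists>f. (\<forall>r\<in>G. adm f r) \<and> f p \<noteq> f q))"

text \<open>The image of \<open>r\<close> under a colouring is defined on a colour as soon as one
  point of that colour lies in \<open>Domain r\<close>. Under this condition a point outside the
  domain is still recognised as such in some image.\<close>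

definition dsep :: "vertex set \<Rightarrow> rel set \<Rightarrow> bool" where
  "dsep X G \<longleftrightarrow> (\<forall>r\<in>G. \<forall>p\<in>X - Domain r.
     \<exists>f c. (\<forall>r\<in>G. adm f r) \<and> (\<forall>x\<in>Domain r. f x = c) \<and> f p \<noteq> c)"

lemma adm_compl: "adm (\<lambda>x. \<not> f x) r \<longleftrightarrow> adm f r"
proof -
  have "adm (\<lambda>x. \<not> g x) r" if "adm g r" for g
    using that unfolding adm_def
  proof
    assume "\<exists>c. \<forall>(p, q)\<in>r. g p = c \<and> g q = (\<not> c)"
    then obtain c where "\<forall>(p, q)\<in>r. g p = c \<and> g q = (\<not> c)" ..
    then have "\<forall>(p, q)\<in>r. (\<not> g p) = (\<not> c) \<and> (\<not> g q) = (\<not> \<not> c)" by auto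
    then show "(\<forall>(p, q)\<in>r. (\<not> g p) = (\<not> g q)) \<or>
        (\<exists>c. \<forall>(p, q)\<in>r. (\<not> g p) = c \<and> (\<not> g q) = (\<not> c))" by blast
  qed auto
  from this[of f] this[of "\<lambda>x. \<not> f x"] show ?thesis by auto
qed

lemma adm_single: "adm f {(p, q)}"
  unfolding adm_def by auto

lemma adm_preserve: "(\<And>x y. (x, y) \<in> r \<Longrightarrow> f x = f y) \<Longrightarrow> adm f r"
  unfolding adm_def by blast

lemma adm_transfer:
  assumes "adm f t" "\<And>x y. (x, y) \<in> r \<Longrightarrow> \<exists>p q. (p, q) \<in> t \<and> g x = f p \<and> g y = f q"
  shows "adm g r"
  using assms(1) unfolding adm_def
proof
  assume *: "\<forall>(p, q)\<in>t. f p = f q"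
  have "g x = g y" if "(x, y) \<in> r" for x y
    using assms(2)[OF that] * by auto
  then show "(\<forall>(x, y)\<in>r. g x = g y) \<or> (\<exists>c. \<forall>(x, y)\<in>r. g x = c \<and> g y = (\<not> c))"
    by (intro disjI1) fast
next
  assume "\<exists>c. \<forall>(p, q)\<in>t. f p = c \<and> f q = (\<not> c)"
  then obtain c where *: "\<And>p q. (p, q) \<in> t \<Longrightarrow> f p = c \<and> f q = (\<not> c)" by blast
  have "g x = c \<and> g y = (\<not> c)" if "(x, y) \<in> r" for x y
    using assms(2)[OF that] * by metis
  then show "(\<forall>(x, y)\<in>r. g x = g y) \<or> (\<exists>c. \<forall>(x, y)\<in>r. g x = c \<and> g y = (\<not> c))"
    by (intro disjI2 exI[of _ c]) fast
qed

locale skeleton =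
  fixes n :: nat
  assumes n3: "3 \<le> n"
begin

abbreviation \<alpha> :: vertex where "\<alpha> \<equiv> V 0"
abbreviation \<beta> :: vertex where "\<beta> \<equiv> V (2 * n)"

text \<open>Skeleton vertices \<open>0, \<dots>, n\<close> lie on the initial path and \<open>n, \<dots>, 2 * n\<close> on the cycle
  through \<open>\<beta>\<close>; the vertex \<open>\<nu>\<close> is \<open>n\<close>. Label \<open>i\<close> with \<open>1 \<le> i \<le> n\<close> has two edges;
  label 0 stands for \<open>x\<^sub>n\<^sub>+\<^sub>1\<close>. The letters \<open>x\<^sub>n\<^sub>+\<^sub>2, \<dots>, x\<^sub>2\<^sub>n\<close> act as a loop at \<open>\<beta>\<close> and need no edges.\<close>

definition edges :: "nat \<Rightarrow> (nat \<times> nat) set" where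
  "edges i = (if i = 0 then {(n, 2 * n)} else {(i - 1, i), (n + i, n + i - 1)})"

text \<open>The gadget replacing an edge shares its end vertices with the skeleton.\<close>

definition emb :: "nat \<Rightarrow> nat \<times> nat \<Rightarrow> vertex \<Rightarrow> vertex" where
  "emb i e p = (if p = \<alpha> then V (fst e) else if p = \<beta> then V (snd e)
     else In i (fst e) (snd e) p)"

text \<open>\<open>r\<close> acts at once in the copies on all edges of label \<open>i\<close>, so
  for \<open>1 \<le> i \<le> n\<close> a nonempty lift has rank at least two.\<close>

definition lift :: "nat \<Rightarrow> rel \<Rightarrow> rel" where
  "lift i r = {(emb i e p, emb i e q) | e p q. e \<in> edges i \<and> (p, q) \<in> r}"

primrec verts :: "nat \<Rightarrow> vertex set" where
  "verts 0 = {\<alpha>, \<beta>}"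
| "verts (Suc h) = {V a | a. a \<le> 2 * n} \<union>
     {In i a b p | i a b p. i \<le> n \<and> (a, b) \<in> edges i \<and> p \<in> verts h - {\<alpha>, \<beta>}}"

text \<open>At positive levels the maps of rank at most one make the family closed under products
  and intersections across different labels. Keeping \<alpha> out of all ranges is essential: labels
  \<open>i\<close> and \<open>i + 1\<close> with \<open>1 \<le> i < n\<close> share the vertices
  \<open>i\<close> and \<open>n + i\<close>, but only the first is a head of label
  \<open>i\<close>.\<close>

primrec pmaps :: "nat \<Rightarrow> rel set" where
  "pmaps 0 = {{}, {(\<alpha>, \<beta>)}}"
| "pmaps (Suc h) = {r. \<exists>p\<in>verts (Suc h). \<exists>q\<in>verts (Suc h) - {\<alpha>}. r \<subseteq> {(p, q)}} \<union>
     {lift i r | i r. i \<le> n \<and> r \<in> pmaps h}"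

lemma lift_E:
  assumes "(x, y) \<in> lift i r"
  obtains e p q where "e \<in> edges i" "(p, q) \<in> r" "x = emb i e p" "y = emb i e q"
  using assms unfolding lift_def by blast

lemma pmaps_cases:
  assumes "r \<in> pmaps (Suc h)"
  obtains p q where "p \<in> verts (Suc h)" "q \<in> verts (Suc h) - {\<alpha>}" "r \<subseteq> {(p, q)}"
  | i t where "r = lift i t" "i \<le> n" "t \<in> pmaps h"
  using assms unfolding pmaps.simps(2) by blast

lemma ab: "\<alpha> \<noteq> \<beta>" using n3 by simp

lemma edges_bound: "\<lbrakk>(a, b) \<in> edges i; i \<le> n\<rbrakk> \<Longrightarrow> a \<le> 2 * n \<and> 0 < b \<and> b \<le> 2 * n \<and> a \<noteq> b"
  using n3 by (auto simp: edges_def split: if_splits)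

lemma emb_simps [simp]:
  "emb i e \<alpha> = V (fst e)" "emb i e \<beta> = V (snd e)"
  using ab by (auto simp: emb_def)

lemma emb_In: "p \<noteq> \<alpha> \<Longrightarrow> p \<noteq> \<beta> \<Longrightarrow> emb i (a, b) p = In i a b p"
  by (simp add: emb_def)

text \<open>The two edges of one label have no vertex in common, so shared end vertices cause no
  confusion either.\<close>

lemma emb_inj:
  assumes "emb i e p = emb i e' q" "e \<in> edges i" "e' \<in> edges i" "i \<le> n"
  shows "e = e' \<and> p = q"
proof -
  obtain a b a' b' where e: "e = (a, b)" "e' = (a', b')" by (cases e, cases e')
  show ?thesis
    using assms n3 unfolding e
    by (cases "p = \<alpha>"; cases "q = \<alpha>"; cases "p = \<beta>"; cases "q = \<beta>")
      (auto simp: edges_def emb_def split: if_splits)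
qed

lemma emb_alpha: "\<lbrakk>emb i e p = \<alpha>; e \<in> edges i; i \<le> n\<rbrakk> \<Longrightarrow> p = \<alpha> \<and> i = 1 \<and> e = (0, 1)"
  using n3 by (auto simp: edges_def emb_def split: if_splits)

lemma emb_verts: "\<lbrakk>p \<in> verts h; e \<in> edges i; i \<le> n\<rbrakk> \<Longrightarrow> emb i e p \<in> verts (Suc h)"
  using edges_bound[of "fst e" "snd e" i] by (cases e) (auto simp: emb_def)

lemma emb_shared:
  assumes "emb i e p = emb j e' q" "i \<noteq> j"
  shows "(p = \<alpha> \<or> p = \<beta>) \<and> (q = \<alpha> \<or> q = \<beta>)"
  using assms by (auto simp: emb_def split: if_splits)

text \<open>As \<open>p \<noteq> \<alpha>\<close>, a shared vertex is a head of label
  \<open>i\<close>. For \<open>i > 0\<close> the heads are \<open>i\<close> and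
  \<open>n + i - 1\<close>. The other labels at the first are \<open>i + 1\<close>, or 0 and 1 if
  \<open>i = n\<close>; at the second \<open>i - 1\<close>, or 0 and \<open>n\<close> if
  \<open>i = 1\<close>. Since \<open>3 \<le> n\<close>, no label is at both.\<close>

lemma shared_vertex_unique:
  assumes "i \<noteq> j" "i \<le> n" "j \<le> n"
    and "e \<in> edges i" "e' \<in> edges j" "emb i e p = emb j e' q" "p \<noteq> \<alpha>"
    and "d \<in> edges i" "d' \<in> edges j" "emb i d p' = emb j d' q'" "p' \<noteq> \<alpha>"
  shows "emb i e p = emb i d p'"
proof -
  obtain a b a' b' c1 c2 d1 d2 where e: "e = (a, b)" "e' = (a', b')" "d = (c1, c2)" "d' = (d1, d2)"
    by (cases e, cases e', cases d, cases d')
  have p: "p = \<beta>" "p' = \<beta>"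
    using emb_shared[OF assms(6,1)] emb_shared[OF assms(10,1)] assms(7,11) by auto
  have "b = a' \<or> b = b'" "c2 = d1 \<or> c2 = d2"
    using emb_shared[OF assms(6,1)] emb_shared[OF assms(10,1)] assms(6,10) p e by auto
  moreover have i: "i = 0 \<and> b = c2 \<or> i > 0 \<and> (b = i \<or> b = n + i - 1) \<and> (c2 = i \<or> c2 = n + i - 1)"
    using assms(4,8) unfolding e edges_def by (auto split: if_splits)
  moreover have "j = 0 \<and> x \<in> {n, 2 * n} \<or> j > 0 \<and> x \<in> {j - 1, j, n + j, n + j - 1}"
    if "x = a' \<or> x = b' \<or> x = d1 \<or> x = d2" for x
    using that assms(5,9) unfolding e edges_def by (auto split: if_splits)
  ultimately have j: "j = 0 \<and> x \<in> {n, 2 * n} \<or> j > 0 \<and> x \<in> {j - 1, j, n + j, n + j - 1}"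
    if "x = b \<or> x = c2" for x
    using that by blast
  have "b = c2"
  proof (rule ccontr)
    assume "b \<noteq> c2"
    with i have i: "i > 0" "b = i \<and> c2 = n + i - 1 \<or> b = n + i - 1 \<and> c2 = i" by auto
    have "j = 0 \<and> (i = n \<or> i = 2 * n) \<or> j > 0 \<and> (i = j - 1 \<or> i = n + j \<or> i = n + j - 1)"
      using j[of i] i(2) assms(1) by auto
    moreover have "j = 0 \<and> (n + i - 1 = n \<or> n + i - 1 = 2 * n) \<or>
       j > 0 \<and> (n + i - 1 = j - 1 \<or> n + i - 1 = j \<or> n + i - 1 = n + j)"
      using j[of "n + i - 1"] i assms(1) by auto
    ultimately show False
      using i(1) assms(1-3) n3 by (elim disjE conjE; linarith)
  qed
  then show ?thesis using p e by simp
qed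

lemma edges_nonempty: "edges i \<noteq> {}"
  by (simp add: edges_def)

lemma pmaps_props:
  "r \<in> pmaps h \<Longrightarrow> r \<subseteq> verts h \<times> (verts h - {\<alpha>}) \<and> single_valued r \<and> single_valued (r\<inverse>) \<and>
     \<not> (\<alpha> \<in> Domain r \<and> \<beta> \<in> Domain r)"
proof (induction h arbitrary: r)
  case 0
  then show ?case using n3 by (auto simp: single_valued_def)
next
  case (Suc h)
  from Suc.prems show ?case
  proof (cases rule: pmaps_cases)
    case (1 p q)
    then show ?thesis using ab unfolding single_valued_def by blast
  next
    case (2 i t)
    note IH = Suc.IH[OF 2(3)]
    have sub: "r \<subseteq> verts (Suc h) \<times> (verts (Suc h) - {\<alpha>})"
    proof (clarify)
      fix x y assume "(x, y) \<in> r"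
      then obtain e p q where *: "e \<in> edges i" "(p, q) \<in> t" "x = emb i e p" "y = emb i e q"
        unfolding 2(1) by (elim lift_E) (rule that)
      then have "p \<in> verts h" "q \<in> verts h" "q \<noteq> \<alpha>" using IH by auto
      then show "x \<in> verts (Suc h) \<and> y \<in> verts (Suc h) - {\<alpha>}"
        unfolding *(3,4) using emb_verts[OF _ *(1) 2(2)] emb_alpha[OF _ *(1) 2(2)] by blast
    qed
    have "single_valued r"
    proof (rule single_valuedI)
      fix x y z assume "(x, y) \<in> r" "(x, z) \<in> r"
      then obtain e p q e' p' q' where "e \<in> edges i" "(p, q) \<in> t" "x = emb i e p" "y = emb i e q"
        "e' \<in> edges i" "(p', q') \<in> t" "x = emb i e' p'" "z = emb i e' q'"
        unfolding 2(1) converse_iff by (elim lift_E) (rule that)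
      then show "y = z"
        using emb_inj[of i e p e' p'] IH 2(2) by (auto dest: single_valuedD)
    qed
    moreover have "single_valued (r\<inverse>)"
    proof (rule single_valuedI)
      fix x y z assume "(x, y) \<in> r\<inverse>" "(x, z) \<in> r\<inverse>"
      then obtain e p q e' p' q' where "e \<in> edges i" "(q, p) \<in> t" "x = emb i e p" "y = emb i e q"
        "e' \<in> edges i" "(q', p') \<in> t" "x = emb i e' p'" "z = emb i e' q'"
        unfolding 2(1) converse_iff by (elim lift_E) (rule that)
      then show "y = z"
        using emb_inj[of i e p e' p'] IH 2(2) by (auto dest: single_valuedD)
    qed
    \<comment> \<open>\<alpha> lies only on an edge of label 1, and \<beta> only on edges of labels
      0 and \<open>n\<close>.\<close>
    moreover have "\<not> (\<alpha> \<in> Domain r \<and> \<beta> \<in> Domain r)"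
    proof
      assume "\<alpha> \<in> Domain r \<and> \<beta> \<in> Domain r"
      then obtain e p e' q where "\<alpha> = emb i e p" "e \<in> edges i" "\<beta> = emb i e' q" "e' \<in> edges i"
        unfolding 2(1) by (elim conjE DomainE lift_E) (rule that)
      moreover from this have "i = 1" using emb_alpha[of i e p] 2(2) by simp
      ultimately show False
        using n3 by (auto simp: edges_def emb_def split: if_splits)
    qed
    ultimately show ?thesis using sub by blast
  qed
qed

lemmas pmaps_sub = pmaps_props[THEN conjunct1]
lemmas pmaps_sv = pmaps_props[THEN conjunct2, THEN conjunct1]
lemmas pmaps_inj = pmaps_props[THEN conjunct2, THEN conjunct2, THEN conjunct1]
lemmas pmaps_dom = pmaps_props[THEN conjunct2, THEN conjunct2, THEN conjunct2]

section \<open>Closure under intersection and composition\<close>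

lemma pmaps_single:
  assumes "\<And>x y x' y'. \<lbrakk>(x, y) \<in> r; (x', y') \<in> r\<rbrakk> \<Longrightarrow> x = x' \<and> y = y'"
    and "r \<subseteq> verts (Suc h) \<times> (verts (Suc h) - {\<alpha>})"
  shows "r \<in> pmaps (Suc h)"
proof (cases "r = {}")
  case True
  have "\<alpha> \<in> verts (Suc h)" "\<beta> \<in> verts (Suc h) - {\<alpha>}" using ab by auto
  then show ?thesis using True unfolding pmaps.simps(2) by blast
next
  case False
  then obtain p q where pq: "(p, q) \<in> r" by auto
  then have "r \<subseteq> {(p, q)}" using assms(1) by fast
  then show ?thesis using pq assms(2) unfolding pmaps.simps(2) by blast
qed

lemma lift_relcomp:
  assumes "i \<le> n"
  shows "lift i r O lift i s = lift i (r O s)"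
proof (intro equalityI subrelI)
  fix x z assume "(x, z) \<in> lift i r O lift i s"
  then obtain e p q e' p' q' where *: "x = emb i e p" "emb i e q = emb i e' p'" "z = emb i e' q'"
    "e \<in> edges i" "e' \<in> edges i" "(p, q) \<in> r" "(p', q') \<in> s"
    by (blast elim: lift_E)
  then have "e = e' \<and> q = p'" using emb_inj assms by blast
  then show "(x, z) \<in> lift i (r O s)" using * unfolding lift_def by blast
qed (unfold lift_def, blast)

lemma lift_inter:
  assumes "i \<le> n"
  shows "lift i r \<inter> lift i s = lift i (r \<inter> s)"
proof (intro equalityI subrelI)
  fix x y assume "(x, y) \<in> lift i r \<inter> lift i s"
  then obtain e p q e' p' q' where *: "x = emb i e p" "y = emb i e q" "x = emb i e' p'"
    "y = emb i e' q'" "e \<in> edges i" "e' \<in> edges i" "(p, q) \<in> r" "(p', q') \<in> s"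
    by (blast elim: lift_E)
  then have "e = e' \<and> p = p' \<and> q = q'" using emb_inj assms by metis
  then show "(x, y) \<in> lift i (r \<inter> s)" using * unfolding lift_def by blast
qed (unfold lift_def, blast)

lemma lift_inter_single:
  assumes "i \<noteq> j" "i \<le> n" "j \<le> n" "r \<in> pmaps h" "s \<in> pmaps h"
    and "(x, y) \<in> lift i r \<inter> lift j s" "(x', y') \<in> lift i r \<inter> lift j s"
  shows "y = y'"
proof -
  obtain e p e' q where 1: "y = emb i e p" "y = emb j e' q" "e \<in> edges i" "e' \<in> edges j"
    "p \<in> Range r"
    using assms(6) by (blast elim: lift_E)
  obtain d p' d' q' where 2: "y' = emb i d p'" "y' = emb j d' q'" "d \<in> edges i" "d' \<in> edges j"
    "p' \<in> Range r"
    using assms(7) by (blast elim: lift_E)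
  have "p \<noteq> \<alpha>" "p' \<noteq> \<alpha>" using pmaps_sub[OF assms(4)] 1(5) 2(5) by auto
  then show ?thesis
    using shared_vertex_unique[OF assms(1-3) 1(3,4) _ _ 2(3,4)] 1(1,2) 2(1,2) by metis
qed

lemma pmaps_inter:
  assumes "r \<in> pmaps h" "s \<in> pmaps h"
  shows "r \<inter> s \<in> pmaps h"
  using assms
proof (induction h arbitrary: r s)
  case 0
  then show ?case by auto
next
  case (Suc h)
  note sub = pmaps_sub[OF Suc.prems(1)] pmaps_sub[OF Suc.prems(2)]
  show ?case
  proof (cases "\<exists>i j r' s'. i \<le> n \<and> j \<le> n \<and> r' \<in> pmaps h \<and> s' \<in> pmaps h \<and> r = lift i r' \<and> s = lift j s'")
    case True
    then obtain i j r' s' where *: "i \<le> n" "j \<le> n" "r' \<in> pmaps h" "s' \<in> pmaps h" "r = lift i r'" "s = lift j s'"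
      by blast
    show ?thesis
    proof (cases "i = j")
      case True
      then have "r \<inter> s = lift i (r' \<inter> s')" using lift_inter * by simp
      then show ?thesis using Suc.IH[OF *(3,4)] *(1) by auto
    next
      case False
      show ?thesis
      proof (rule pmaps_single)
        fix x y x' y' assume a: "(x, y) \<in> r \<inter> s" "(x', y') \<in> r \<inter> s"
        then have "y = y'" using lift_inter_single[OF False *(1-4)] *(5,6) by blast
        then show "x = x' \<and> y = y'"
          using a pmaps_inj[OF Suc.prems(1)] by (auto dest: single_valuedD)
      qed (use sub in blast)
    qed
  next
    case False
    then have "(\<exists>p q. r \<subseteq> {(p, q)}) \<or> (\<exists>p q. s \<subseteq> {(p, q)})"
      using Suc.prems unfolding pmaps.simps(2) by blast
    then show ?thesis
      by (intro pmaps_single) (use sub in blast)+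
  qed
qed

text \<open>Maps of different labels compose through a vertex common to both kinds of gadget that
  lies in the range of the first map. Such a vertex is unique, so the product has rank at most
  one.\<close>

lemma pmaps_relcomp:
  assumes "r \<in> pmaps h" "s \<in> pmaps h"
  shows "r O s \<in> pmaps h"
  using assms
proof (induction h arbitrary: r s)
  case 0
  then show ?case using n3 by auto
next
  case (Suc h)
  note sub = pmaps_sub[OF Suc.prems(1)] pmaps_sub[OF Suc.prems(2)]
  note sv = single_valuedD[OF pmaps_sv[OF Suc.prems(2)]]
    and inj = single_valuedD[OF pmaps_inj[OF Suc.prems(1)]]
  have sub': "r O s \<subseteq> verts (Suc h) \<times> (verts (Suc h) - {\<alpha>})" using sub by blast
  have single: "r O s \<in> pmaps (Suc h)" if "\<And>x x' y y' z z'. \<lbrakk>(x, y) \<in> r; (x', y') \<in> r; (y, z) \<in> s; (y', z') \<in> s\<rbrakk> \<Longrightarrow> y = y'"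
  proof (rule pmaps_single[OF _ sub'])
    fix x z x' z' assume "(x, z) \<in> r O s" "(x', z') \<in> r O s"
    then obtain y y' where y: "(x, y) \<in> r" "(x', y') \<in> r" "(y, z) \<in> s" "(y', z') \<in> s" by blast
    then have "y = y'" using that by blast
    then show "x = x' \<and> z = z'" using y sv inj by blast
  qed
  show ?case
  proof (cases "\<exists>i j r' s'. i \<le> n \<and> j \<le> n \<and> r' \<in> pmaps h \<and> s' \<in> pmaps h \<and> r = lift i r' \<and> s = lift j s'")
    case True
    then obtain i j r' s' where *: "i \<le> n" "j \<le> n" "r' \<in> pmaps h" "s' \<in> pmaps h" "r = lift i r'" "s = lift j s'"
      by blast
    show ?thesis
    proof (cases "i = j")
      case True
      then have "r O s = lift i (r' O s')" using lift_relcomp * by simp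
      then show ?thesis using Suc.IH[OF *(3,4)] *(1) by auto
    next
      case False
      show ?thesis
      proof (rule single)
        fix x x' y y' z z' assume a: "(x, y) \<in> r" "(x', y') \<in> r" "(y, z) \<in> s" "(y', z') \<in> s"
        obtain e p e' q where 1: "y = emb i e p" "y = emb j e' q" "e \<in> edges i" "e' \<in> edges j"
          "p \<in> Range r'"
          using a(1,3) *(5,6) by (blast elim: lift_E)
        obtain d p' d' q' where 2: "y' = emb i d p'" "y' = emb j d' q'" "d \<in> edges i" "d' \<in> edges j"
          "p' \<in> Range r'"
          using a(2,4) *(5,6) by (blast elim: lift_E)
        have "p \<noteq> \<alpha>" "p' \<noteq> \<alpha>" using pmaps_sub[OF *(3)] 1(5) 2(5) by auto
        then show "y = y'"
          using shared_vertex_unique[OF False *(1,2) 1(3,4) _ _ 2(3,4)] 1(1,2) 2(1,2) by metis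
      qed
    qed
  next
    case False
    then have "(\<exists>p q. r \<subseteq> {(p, q)}) \<or> (\<exists>p q. s \<subseteq> {(p, q)})"
      using Suc.prems unfolding pmaps.simps(2) by blast
    then show ?thesis
      by (intro single) blast
  qed
qed

lemma lift_inj:
  assumes "lift i r = lift i s" "i \<le> n"
  shows "r = s"
proof -
  have "r \<subseteq> s" if eq: "lift i r = lift i s" for r s
  proof (rule subrelI)
    fix p q assume "(p, q) \<in> r"
    obtain e where e: "e \<in> edges i" using edges_nonempty by blast
    then have "(emb i e p, emb i e q) \<in> lift i r"
      using \<open>(p, q) \<in> r\<close> unfolding lift_def by blast
    then obtain e' p' q' where *: "e' \<in> edges i" "(p', q') \<in> s"
      "emb i e p = emb i e' p'" "emb i e q = emb i e' q'"
      unfolding eq by (elim lift_E)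
    then have "p = p'" "q = q'" using emb_inj e assms(2) by blast+
    then show "(p, q) \<in> s" using * by simp
  qed
  then show ?thesis using assms(1) by blast
qed

section \<open>Two-colourings of the initial path\<close>

lemma colour_two_labels:
  assumes "i \<noteq> j" "0 < i" "i \<le> n" "0 < j" "j \<le> n"
  obtains \<gamma> :: "nat \<Rightarrow> bool" where "\<gamma> 0 \<noteq> \<gamma> n" "\<gamma> (i - 1) \<noteq> \<gamma> i" "\<gamma> (j - 1) \<noteq> \<gamma> j"
proof -
  \<comment> \<open>Different colours at \<open>0\<close> and \<open>n\<close> force an odd number
    of colour changes, so a third label has to join \<open>i\<close> and \<open>j\<close>.\<close>
  have "\<exists>k. 0 < k \<and> k \<le> 3 \<and> k \<noteq> i \<and> k \<noteq> j" by presburger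
  then obtain k where "0 < k" "k \<le> n" "k \<noteq> i" "k \<noteq> j" using n3 by auto
  then show thesis
    using assms by (intro that[of "\<lambda>x. (i \<le> x) \<noteq> ((j \<le> x) \<noteq> (k \<le> x))"]) auto
qed

text \<open>The colouring of the path is repeated in complemented form on the cycle. A single
  threshold suffices; the excluded vertices \<open>0\<close> and \<open>2 * n\<close> always agree
  because \<open>\<gamma> 0 \<noteq> \<gamma> n\<close>.\<close>

lemma colour_two_vertices:
  assumes "a < b" "b \<le> 2 * n" "\<not> (a = 0 \<and> b = 2 * n)"
  obtains \<gamma> :: "nat \<Rightarrow> bool" where "\<gamma> 0 \<noteq> \<gamma> n"
    "(if a \<le> n then \<gamma> a else \<not> \<gamma> (a - n)) \<noteq> (if b \<le> n then \<gamma> b else \<not> \<gamma> (b - n))"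
proof -
  consider "b \<le> n" | "n < a" | "a \<le> n" "n < b" "0 < a" | "a \<le> n" "n < b" "a = 0" by linarith
  then show thesis
  proof cases
    case 1
    then show ?thesis using assms by (intro that[of "\<lambda>x. b \<le> x"]) auto
  next
    case 2
    then show ?thesis using assms by (intro that[of "\<lambda>x. b - n \<le> x"]) auto
  next
    case 3
    then show ?thesis using assms n3 by (intro that[of "\<lambda>x. 1 \<le> x"]) auto
  next
    case 4
    then show ?thesis using assms n3 by (intro that[of "\<lambda>x. n \<le> x"]) auto
  qed
qed

text \<open>If the threshold \<open>i\<close> gives \<open>a\<close> the wrong colour, a second
  change next to label \<open>i\<close> corrects it and a third one restores the parity. In the two
  excluded cases the conditions contradict \<open>\<gamma> 0 \<noteq> \<gamma> n\<close>.\<close>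

lemma colour_label_vertex:
  assumes "0 < i" "i \<le> n" "a \<le> 2 * n" "a \<notin> {i - 1, i, n + i, n + i - 1}"
    and "\<not> (s \<and> a = 0 \<and> i = n)" "\<not> (s \<and> a = 2 * n \<and> i = 1)"
  obtains \<gamma> :: "nat \<Rightarrow> bool" where "\<gamma> 0 \<noteq> \<gamma> n" "\<gamma> (i - 1) \<noteq> \<gamma> i"
    "(if a \<le> n then \<gamma> a else \<not> \<gamma> (a - n)) = (if s then \<gamma> i else \<gamma> (i - 1))"
proof -
  \<comment> \<open>With \<open>\<gamma> (i - 1)\<close> false and \<open>\<gamma> i\<close> true,
    the condition on \<open>a\<close> says that the path vertex \<open>r\<close> has colour
    \<open>\<tau>\<close>.\<close>
  define r where "r = (if a \<le> n then a else a - n)"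
  define \<tau> where "\<tau> = (if a \<le> n then s else \<not> s)"
  have "r \<le> n \<and> r \<noteq> i - 1 \<and> r \<noteq> i"
  proof (cases "a \<le> n")
    case True
    then show ?thesis using assms(4) by (simp add: r_def)
  next
    case False
    then have "a = n + r" by (simp add: r_def)
    moreover have "a \<noteq> n + i" "a \<noteq> n + i - 1" using assms(4) by simp_all
    ultimately show ?thesis using assms(1,3) by linarith
  qed
  then have r: "r \<le> n" "r \<noteq> i - 1" "r \<noteq> i" by simp_all
  note result = that
  have *: thesis if \<gamma>: "\<gamma> 0 \<noteq> \<gamma> n" "\<not> \<gamma> (i - 1)" "\<gamma> i" "\<gamma> r = \<tau>" for \<gamma>
  proof (rule result[of \<gamma>])
    show "(if a \<le> n then \<gamma> a else \<not> \<gamma> (a - n)) = (if s then \<gamma> i else \<gamma> (i - 1))"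
      using \<gamma> unfolding r_def \<tau>_def by (cases "a \<le> n"; cases s) simp_all
  qed (use \<gamma>(1-3) in simp_all)
  consider "(i \<le> r) = \<tau>" | "i < r" "r < n" "\<not> \<tau>" | "i < r" "r = n" "\<not> \<tau>"
    | "r < i - 1" "0 < r" "\<tau>" | "r < i - 1" "r = 0" "\<tau>"
  proof -
    have "(i \<le> r) = \<tau> \<or> i < r \<and> r < n \<and> \<not> \<tau> \<or> i < r \<and> r = n \<and> \<not> \<tau> \<or>
      r < i - 1 \<and> 0 < r \<and> \<tau> \<or> r < i - 1 \<and> r = 0 \<and> \<tau>"
      using r assms(1) by (cases \<tau>) auto
    then show thesis using that by meson
  qed
  then show thesis
  proof cases
    case 1
    then show ?thesis using assms by (intro *[of "\<lambda>x. i \<le> x"]) auto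
  next
    case 2
    then show ?thesis using assms
      by (intro *[of "\<lambda>x. (i \<le> x) \<noteq> ((i + 1 \<le> x) \<noteq> (n \<le> x))"]) auto
  next
    case 3
    then have "i \<noteq> 1" using assms by (auto simp: r_def \<tau>_def split: if_splits)
    with 3 show ?thesis using assms
      by (intro *[of "\<lambda>x. (i \<le> x) \<noteq> ((i + 1 \<le> x) \<noteq> (x < 1))"]) auto
  next
    case 4
    then show ?thesis using assms
      by (intro *[of "\<lambda>x. (i \<le> x) \<noteq> ((i - 1 \<le> x) \<noteq> (1 \<le> x))"]) auto
  next
    case 5
    then have "i \<noteq> n" using assms by (auto simp: r_def \<tau>_def split: if_splits)
    with 5 show ?thesis using assms
      by (intro *[of "\<lambda>x. (i \<le> x) \<noteq> ((i - 1 \<le> x) \<noteq> (x < n))"]) auto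
  qed
qed

text \<open>The counterpart for label 0, whose edge from \<open>n\<close> to \<open>2 * n\<close>
  always changes colour. Vertex \<open>0\<close> never has the colour of \<open>n\<close>, hence the
  exclusion.\<close>

lemma colour_vertex:
  assumes "a \<le> 2 * n" "a \<noteq> n" "a \<noteq> 2 * n" "\<not> (a = 0 \<and> \<not> s)"
  obtains \<gamma> :: "nat \<Rightarrow> bool" where "\<gamma> 0 \<noteq> \<gamma> n"
    "(if a \<le> n then \<gamma> a else \<not> \<gamma> (a - n)) = (\<gamma> n \<noteq> s)"
proof (cases "a = 0")
  case True
  then show ?thesis using assms n3 by (intro that[of "\<lambda>x. 1 \<le> x"]) simp_all
next
  case False
  define r where "r = (if a \<le> n then a else a - n)"
  have r: "0 < r" "r < n" using assms False by (auto simp: r_def)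
  show ?thesis
  proof (cases "s = (a \<le> n)")
    case True
    then show ?thesis using r assms n3
      by (intro that[of "\<lambda>x. r + 1 \<le> x"]) (simp_all add: r_def)
  next
    case False
    then show ?thesis using r assms n3
      by (intro that[of "\<lambda>x. r \<le> x"]) (simp_all add: r_def)
  qed
qed

end

section \<open>Separation by admissible colourings\<close>

text \<open>The inductive step from level \<open>h\<close> to \<open>Suc h\<close>:
  \<open>L i\<close> holds the maps acting inside the gadgets of label \<open>i\<close>, where
  separation is already known, and no map acts inside those of label \<open>i0\<close>.\<close>

locale composite = skeleton +
  fixes h :: nat and G :: "rel set" and L :: "nat \<Rightarrow> rel set" and i0 :: nat
  assumes G_cases: "\<And>r. r \<in> G \<Longrightarrow>
      (\<exists>p\<in>verts (Suc h). \<exists>q. r = {(p, q)}) \<or> (\<exists>i\<le>n. \<exists>t\<in>L i. r = lift i t)"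
    and sepL: "\<And>i. i \<le> n \<Longrightarrow> sep (verts h) (L i)"
    and dsepL: "\<And>i. i \<le> n \<Longrightarrow> dsep (verts h) (L i)"
    and L_T: "\<And>i t. \<lbrakk>i \<le> n; t \<in> L i\<rbrakk> \<Longrightarrow> t \<in> pmaps h \<and> t \<noteq> {}"
    and i0: "0 < i0" "i0 \<le> n" "L i0 = {}"
begin

abbreviation cut :: "nat \<Rightarrow> (vertex \<Rightarrow> bool) \<Rightarrow> bool" where
  "cut i f \<equiv> \<forall>r\<in>L i. adm f r"

abbreviation Cut :: "(vertex \<Rightarrow> bool) \<Rightarrow> bool" where
  "Cut f \<equiv> \<forall>r\<in>G. adm f r"

lemma ab_verts: "\<alpha> \<in> verts k" "\<beta> \<in> verts k"
  by (cases k; auto)+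

section \<open>Colourings of a single gadget\<close>

lemma sepE:
  assumes "i \<le> n" "p \<in> verts h" "q \<in> verts h" "p \<noteq> q"
  obtains f where "cut i f" "f p = c" "f q = (\<not> c)"
proof -
  obtain f where f: "cut i f" "f p \<noteq> f q"
    using sepL assms unfolding sep_def by metis
  show thesis
  proof (cases "f p = c")
    case True
    with f show ?thesis by (intro that[of f]) auto
  next
    case False
    with f show ?thesis by (intro that[of "\<lambda>x. \<not> f x"]) (auto simp: adm_compl)
  qed
qed

text \<open>An inner vertex of a gadget is either cut off from both ends at once, or its colour can be
  prescribed independently of the colours of the ends.\<close>

lemma control:
  assumes "i \<le> n" "p \<in> verts h" "p \<noteq> \<alpha>" "p \<noteq> \<beta>"
  obtains f where "cut i f" "f \<alpha> = f \<beta>" "f p \<noteq> f \<alpha>"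
  | "\<And>c d. \<exists>f. cut i f \<and> f \<alpha> = c \<and> f \<beta> = (\<not> c) \<and> f p = d"
proof (cases "\<exists>f. cut i f \<and> f \<alpha> = f \<beta> \<and> f p \<noteq> f \<alpha>")
  case True
  then show ?thesis using that(1) by blast
next
  case False
  \<comment> \<open>Separate \<open>p\<close> from the end that is to get the other colour; the
    remaining end then has the colour of \<open>p\<close>, as otherwise \<open>p\<close> would be
    cut off from both ends.\<close>
  have "\<exists>f. cut i f \<and> f \<alpha> = c \<and> f \<beta> = (\<not> c) \<and> f p = d" for c d
  proof (cases "d = c")
    case True
    obtain f where "cut i f" "f p = d" "f \<beta> = (\<not> d)"
      using sepE[OF assms(1,2) ab_verts(2) assms(4)] by blast
    then show ?thesis using False True by (intro exI[of _ f]) metis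
  next
    case d: False
    obtain f where "cut i f" "f p = d" "f \<alpha> = (\<not> d)"
      using sepE[OF assms(1,2) ab_verts(1) assms(3)] by blast
    then show ?thesis using False d by (intro exI[of _ f]) metis
  qed
  then show ?thesis using that(2) by blast
qed

lemma dsepE:
  assumes "i \<le> n" "t \<in> L i" "p \<in> verts h" "p \<notin> Domain t"
  obtains f where "cut i f" "\<forall>x\<in>Domain t. f x = c" "f p = (\<not> c)"
proof -
  have "p \<in> verts h - Domain t" using assms(3,4) by blast
  from dsepL[OF assms(1), unfolded dsep_def, THEN bspec, OF assms(2), THEN bspec, OF this]
  obtain f d where f: "cut i f" "\<forall>x\<in>Domain t. f x = d" "f p \<noteq> d"
    by (elim exE conjE)
  show thesis
  proof (cases "d = c")
    case True
    with f show ?thesis by (intro that[of f]) auto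
  next
    case False
    with f show ?thesis by (intro that[of "\<lambda>x. \<not> f x"]) (auto simp: adm_compl)
  qed
qed

text \<open>The analogue of \<open>control\<close> for a domain, which misses at least one end. If
  it cannot be cut off from both ends at once, a colouring separating it from the missed end gives
  it the colour of the other end, which is \<alpha> if \<open>s\<close> and \<beta>
  otherwise.\<close>

lemma domain_control:
  assumes "i \<le> n" "t \<in> L i"
  obtains f where "cut i f" "f \<alpha> = f \<beta>" "\<forall>x\<in>Domain t. f x = (\<not> f \<alpha>)"
  | s where "\<And>c. \<exists>f. cut i f \<and> f \<alpha> = c \<and> f \<beta> = (\<not> c) \<and> (\<forall>x\<in>Domain t. f x = (c = s))"
proof (cases "\<exists>f. cut i f \<and> f \<alpha> = f \<beta> \<and> (\<forall>x\<in>Domain t. f x = (\<not> f \<alpha>))")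
  case True
  then show ?thesis using that(1) by blast
next
  case False
  have "\<alpha> \<notin> Domain t \<or> \<beta> \<notin> Domain t"
    using pmaps_dom[of t h] L_T[OF assms] by blast
  then show ?thesis
  proof
    assume a: "\<alpha> \<notin> Domain t"
    have "\<exists>f. cut i f \<and> f \<alpha> = c \<and> f \<beta> = (\<not> c) \<and> (\<forall>x\<in>Domain t. f x = (c = False))" for c
    proof -
      obtain f where f: "cut i f" "\<forall>x\<in>Domain t. f x = (\<not> c)" "f \<alpha> = (\<not> \<not> c)"
        using dsepE[OF assms ab_verts(1) a] by blast
      with False have "f \<beta> = (\<not> c)" by (metis (full_types))
      with f show ?thesis by (intro exI[of _ f]) auto
    qed
    then show ?thesis using that(2) by blast
  next
    assume b: "\<beta> \<notin> Domain t"
    have "\<exists>f. cut i f \<and> f \<alpha> = c \<and> f \<beta> = (\<not> c) \<and> (\<forall>x\<in>Domain t. f x = (c = True))" for c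
    proof -
      obtain f where f: "cut i f" "\<forall>x\<in>Domain t. f x = c" "f \<beta> = (\<not> c)"
        using dsepE[OF assms ab_verts(2) b] by blast
      with False have "f \<alpha> = c" by (metis (full_types))
      with f show ?thesis by (intro exI[of _ f]) auto
    qed
    then show ?thesis using that(2) by blast
  qed
qed

section \<open>Assembling colourings of the composite graph\<close>

definition loc :: "nat \<Rightarrow> (vertex \<Rightarrow> bool) \<Rightarrow> vertex \<Rightarrow> bool" where
  "loc i f x = (case x of V a \<Rightarrow> f \<alpha> | In j a b p \<Rightarrow> if j = i then f p else f \<alpha>)"

lemma loc_emb: "f \<alpha> = f \<beta> \<Longrightarrow> loc i f (emb j e p) = (if j = i then f p else f \<alpha>)"
  by (auto simp: loc_def emb_def)

text \<open>Since both ends agree, everything outside the gadgets of label \<open>i\<close> can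
  carry their common colour, and maps of other labels meet a single colour.\<close>

lemma Cut_loc:
  assumes "cut i f" "f \<alpha> = f \<beta>"
  shows "Cut (loc i f)"
proof
  fix r assume "r \<in> G"
  from G_cases[OF this] show "adm (loc i f) r"
  proof (elim disjE bexE exE conjE)
    fix j t assume j: "j \<le> n" "t \<in> L j" "r = lift j t"
    show ?thesis
    proof (cases "j = i")
      case True
      then have "adm f t" using assms(1) j by blast
      then show ?thesis
      proof (rule adm_transfer)
        fix x y assume "(x, y) \<in> r"
        then show "\<exists>p q. (p, q) \<in> t \<and> loc i f x = f p \<and> loc i f y = f q"
          unfolding j(3) by (elim lift_E) (use True loc_emb[of f j] assms(2) in auto)
      qed
    next
      case False
      show ?thesis
      proof (rule adm_preserve)
        fix x y assume "(x, y) \<in> r"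
        then show "loc i f x = loc i f y"
          unfolding j(3) by (elim lift_E) (use False loc_emb[of f i] assms(2) in auto)
      qed
    qed
  qed (simp add: adm_single)
qed

definition ext :: "(nat \<Rightarrow> bool) \<Rightarrow> (nat \<Rightarrow> vertex \<Rightarrow> bool) \<Rightarrow> vertex \<Rightarrow> bool" where
  "ext g \<psi> x = (case x of V a \<Rightarrow> g a | In i a b p \<Rightarrow> if g a = g b then g a else \<psi> i p)"

lemma ext_emb_flip:
  "\<lbrakk>g (fst e) = \<psi> i \<alpha>; g (snd e) = \<psi> i \<beta>; \<psi> i \<alpha> \<noteq> \<psi> i \<beta>\<rbrakk> \<Longrightarrow> ext g \<psi> (emb i e p) = \<psi> i p"
  by (auto simp: ext_def emb_def)

lemma ext_emb_const:
  "g (fst e) = g (snd e) \<Longrightarrow> ext g \<psi> (emb i e p) = g (fst e)"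
  by (auto simp: ext_def emb_def)

lemma ext_V [simp]: "ext g \<psi> (V a) = g a"
  by (simp add: ext_def)

text \<open>A lift acts on all edges of its label, so a colour change must run in the same direction
  on each of them.\<close>

lemma Cut_ext:
  assumes "\<And>i. \<lbrakk>i \<le> n; L i \<noteq> {}\<rbrakk> \<Longrightarrow> (\<forall>e\<in>edges i. g (fst e) = g (snd e)) \<or>
    (\<forall>e\<in>edges i. g (fst e) = \<psi> i \<alpha> \<and> g (snd e) = \<psi> i \<beta>) \<and> \<psi> i \<alpha> \<noteq> \<psi> i \<beta> \<and> cut i (\<psi> i)"
  shows "Cut (ext g \<psi>)"
proof
  fix r assume "r \<in> G"
  from G_cases[OF this] show "adm (ext g \<psi>) r"
  proof (elim disjE bexE exE conjE)
    fix i t assume i: "i \<le> n" "t \<in> L i" "r = lift i t"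
    from assms[of i] i consider "\<forall>e\<in>edges i. g (fst e) = g (snd e)" |
      "\<forall>e\<in>edges i. g (fst e) = \<psi> i \<alpha> \<and> g (snd e) = \<psi> i \<beta>" "\<psi> i \<alpha> \<noteq> \<psi> i \<beta>" "cut i (\<psi> i)"
      by blast
    then show ?thesis
    proof cases
      case 1
      show ?thesis
      proof (rule adm_preserve)
        fix x y assume "(x, y) \<in> r"
        then obtain e p q where "e \<in> edges i" "x = emb i e p" "y = emb i e q"
          unfolding i(3) by (elim lift_E)
        then show "ext g \<psi> x = ext g \<psi> y" using ext_emb_const[of g e] 1 by metis
      qed
    next
      case 2
      have "adm (\<psi> i) t" using 2 i(2) by blast
      then show ?thesis
      proof (rule adm_transfer)
        fix x y assume "(x, y) \<in> r"
        then obtain e p q where "e \<in> edges i" "(p, q) \<in> t" "x = emb i e p" "y = emb i e q"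
          unfolding i(3) by (elim lift_E)
        then show "\<exists>p q. (p, q) \<in> t \<and> ext g \<psi> x = \<psi> i p \<and> ext g \<psi> y = \<psi> i q"
          using ext_emb_flip[of g e] 2 by metis
      qed
    qed
  qed (simp add: adm_single)
qed

text \<open>Colourings of the skeleton for which both copies of each gadget change colour
  in the same way.\<close>

definition sk :: "(nat \<Rightarrow> bool) \<Rightarrow> nat \<Rightarrow> bool" where
  "sk \<gamma> a = (if a \<le> n then \<gamma> a else \<not> \<gamma> (a - n))"

definition src :: "(nat \<Rightarrow> bool) \<Rightarrow> nat \<Rightarrow> bool" where
  "src \<gamma> i = (if i = 0 then \<gamma> n else \<gamma> (i - 1))"

definition flips :: "(nat \<Rightarrow> bool) \<Rightarrow> nat \<Rightarrow> bool" where
  "flips \<gamma> i \<longleftrightarrow> i = 0 \<or> \<gamma> (i - 1) \<noteq> \<gamma> i"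

definition good :: "(nat \<Rightarrow> bool) \<Rightarrow> (nat \<Rightarrow> vertex \<Rightarrow> bool) \<Rightarrow> bool" where
  "good \<gamma> \<psi> \<longleftrightarrow> (\<forall>i\<le>n. cut i (\<psi> i) \<and> \<psi> i \<alpha> = src \<gamma> i \<and> \<psi> i \<beta> = (\<not> src \<gamma> i))"

text \<open>The second edge of label \<open>i\<close> is traversed against the order of the path and
  coloured by the complement. The two reversals cancel, so both edges change colour in the same
  direction. The two halves fit together at \<open>n\<close> because
  \<open>\<gamma> 0 \<noteq> \<gamma> n\<close>.\<close>

lemma sk_edges:
  assumes "\<gamma> 0 \<noteq> \<gamma> n" "e \<in> edges i" "i \<le> n"
  shows "if flips \<gamma> i then sk \<gamma> (fst e) = src \<gamma> i \<and> sk \<gamma> (snd e) = (\<not> src \<gamma> i)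
    else sk \<gamma> (fst e) = sk \<gamma> (snd e)"
proof (cases "i = 0 \<or> i = 1")
  case True
  then show ?thesis
    using assms n3 by (auto simp: edges_def sk_def src_def flips_def)
next
  case False
  then have i: "2 \<le> i" by linarith
  then have "sk \<gamma> (i - 1) = \<gamma> (i - 1)" "sk \<gamma> i = \<gamma> i" "sk \<gamma> (n + i) = (\<not> \<gamma> i)"
    using assms(3) by (simp_all add: sk_def)
  moreover have "sk \<gamma> (n + i - 1) = (\<not> \<gamma> (i - 1))"
  proof -
    have "n + i - 1 = n + (i - 1)" "0 < i - 1" using i by linarith+
    then show ?thesis by (simp add: sk_def)
  qed
  moreover have "e = (i - 1, i) \<or> e = (n + i, n + i - 1)"
    using assms(2) i by (simp add: edges_def)
  ultimately show ?thesis
    using i unfolding src_def flips_def by (elim disjE) simp_all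
qed

lemma good_exists: "\<exists>\<psi>. good \<gamma> \<psi>"
proof -
  have "\<exists>f. i \<le> n \<longrightarrow> cut i f \<and> f \<alpha> = src \<gamma> i \<and> f \<beta> = (\<not> src \<gamma> i)" for i
    using sepE[OF _ ab_verts ab] by metis
  then have "\<exists>\<psi>. \<forall>i. i \<le> n \<longrightarrow> cut i (\<psi> i) \<and> \<psi> i \<alpha> = src \<gamma> i \<and> \<psi> i \<beta> = (\<not> src \<gamma> i)"
    by (intro choice allI)
  then show ?thesis unfolding good_def by blast
qed

lemma good_upd:
  "\<lbrakk>good \<gamma> \<psi>; cut i f; f \<alpha> = src \<gamma> i; f \<beta> = (\<not> src \<gamma> i)\<rbrakk> \<Longrightarrow> good \<gamma> (\<psi>(i := f))"
  by (simp add: good_def)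

lemma Cut_good:
  assumes "\<gamma> 0 \<noteq> \<gamma> n" "good \<gamma> \<psi>"
  shows "Cut (ext (sk \<gamma>) \<psi>)"
proof (rule Cut_ext)
  fix i assume i: "i \<le> n"
  show "(\<forall>e\<in>edges i. sk \<gamma> (fst e) = sk \<gamma> (snd e)) \<or>
    (\<forall>e\<in>edges i. sk \<gamma> (fst e) = \<psi> i \<alpha> \<and> sk \<gamma> (snd e) = \<psi> i \<beta>) \<and> \<psi> i \<alpha> \<noteq> \<psi> i \<beta> \<and> cut i (\<psi> i)"
  proof (cases "flips \<gamma> i")
    case True
    then show ?thesis
      using sk_edges[OF assms(1) _ i] assms(2) i unfolding good_def by auto
  next
    case False
    then show ?thesis
      using sk_edges[OF assms(1) _ i] by (intro disjI1) auto
  qed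
qed

lemma good_flip:
  assumes "\<gamma> 0 \<noteq> \<gamma> n" "good \<gamma> \<psi>" "flips \<gamma> i" "i \<le> n" "e \<in> edges i"
  shows "ext (sk \<gamma>) \<psi> (emb i e p) = \<psi> i p"
  using sk_edges[OF assms(1,5,4)] assms(2-4) by (intro ext_emb_flip) (auto simp: good_def)

lemma good_const:
  assumes "\<gamma> 0 \<noteq> \<gamma> n" "\<not> flips \<gamma> i" "i \<le> n" "e \<in> edges i"
  shows "ext (sk \<gamma>) \<psi> (emb i e p) = sk \<gamma> (fst e)"
  using sk_edges[OF assms(1,4,3)] assms(2) by (intro ext_emb_const) auto

text \<open>The unused gadget disconnects the start and the end of the skeleton
  from its middle part.\<close>

lemma Cut_start: "Cut (ext (\<lambda>a. a < i0) \<psi>)"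
proof (rule Cut_ext)
  fix i assume "i \<le> n" "L i \<noteq> {}"
  then have "i \<noteq> i0" using i0 by auto
  then show "(\<forall>e\<in>edges i. (fst e < i0) = (snd e < i0)) \<or>
    (\<forall>e\<in>edges i. (fst e < i0) = \<psi> i \<alpha> \<and> (snd e < i0) = \<psi> i \<beta>) \<and> \<psi> i \<alpha> \<noteq> \<psi> i \<beta> \<and> cut i (\<psi> i)"
    using i0(1,2) by (intro disjI1) (auto simp: edges_def)
qed

text \<open>The set \<open>a \<ge> n + i0\<close> is left only along an edge of label
  \<open>i0\<close> and entered only along the edge of label 0, where \<open>\<psi> 0\<close>
  supplies the colour change.\<close>

lemma Cut_end:
  assumes "cut 0 (\<psi> 0)" "\<not> \<psi> 0 \<alpha>" "\<psi> 0 \<beta>"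
  shows "Cut (ext (\<lambda>a. n + i0 \<le> a) \<psi>)"
proof (rule Cut_ext)
  fix i assume "i \<le> n" "L i \<noteq> {}"
  then have "i \<noteq> i0" using i0 by auto
  then show "(\<forall>e\<in>edges i. (n + i0 \<le> fst e) = (n + i0 \<le> snd e)) \<or>
    (\<forall>e\<in>edges i. (n + i0 \<le> fst e) = \<psi> i \<alpha> \<and> (n + i0 \<le> snd e) = \<psi> i \<beta>) \<and> \<psi> i \<alpha> \<noteq> \<psi> i \<beta> \<and> cut i (\<psi> i)"
    using i0(1,2) assms \<open>i \<le> n\<close> by (cases "i = 0") (auto simp: edges_def)
qed

lemma flips_exists:
  assumes "i \<le> n"
  obtains \<gamma> where "\<gamma> 0 \<noteq> \<gamma> n" "flips \<gamma> i"
proof (cases "i = 0")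
  case True
  then show ?thesis using n3 by (intro that[of "\<lambda>x. 1 \<le> x"]) (simp_all add: flips_def)
next
  case False
  then show ?thesis using assms by (intro that[of "\<lambda>x. i \<le> x"]) (simp_all add: flips_def)
qed

lemma orient:
  assumes "cut i f" "f \<alpha> \<noteq> f \<beta>"
  obtains f' where "cut i f'" "f' \<alpha> = c" "f' \<beta> = (\<not> c)" "\<forall>x y. (f' x = f' y) = (f x = f y)"
proof (cases "f \<alpha> = c")
  case True
  then show ?thesis using assms by (intro that[of f]) auto
next
  case False
  then show ?thesis using assms by (intro that[of "\<lambda>x. \<not> f x"]) (auto simp: adm_compl)
qed

section \<open>Separating two vertices\<close>

lemma sep_V:
  assumes "a < b" "b \<le> 2 * n"
  shows "\<exists>F. Cut F \<and> F (V a) \<noteq> F (V b)"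
proof (cases "a = 0 \<and> b = 2 * n")
  case True
  \<comment> \<open>The colourings \<open>sk \<gamma>\<close> with
    \<open>\<gamma> 0 \<noteq> \<gamma> n\<close> never distinguish \<alpha> from \<beta>; the cut
    at \<open>i0\<close> does.\<close>
  have "ext (\<lambda>a. a < i0) undefined (V a) \<noteq> ext (\<lambda>a. a < i0) undefined (V b)"
    using True i0 by simp
  then show ?thesis using Cut_start by blast
next
  case False
  from colour_two_vertices[OF assms False] obtain \<gamma> where \<gamma>: "\<gamma> 0 \<noteq> \<gamma> n" "sk \<gamma> a \<noteq> sk \<gamma> b"
    unfolding sk_def .
  obtain \<psi> where "good \<gamma> \<psi>" using good_exists by blast
  then show ?thesis using Cut_good[OF \<gamma>(1)] \<gamma>(2)
    by (intro exI[of _ "ext (sk \<gamma>) \<psi>"]) simp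
qed

lemma sep_In:
  assumes i: "i \<le> n" "(a, b) \<in> edges i" and p: "p \<in> verts h" "p \<noteq> \<alpha>" "p \<noteq> \<beta>"
    and y: "y \<in> verts (Suc h)" "y \<noteq> In i a b p"
  shows "\<exists>F. Cut F \<and> F (In i a b p) \<noteq> F y"
proof -
  note x = emb_In[OF p(2,3), of i a b, symmetric]
  show ?thesis
  proof (cases "\<exists>a' b' q. y = In i a' b' q")
    case True
    then obtain a' b' q where y': "y = In i a' b' q" "(a', b') \<in> edges i"
      and q: "q \<in> verts h" "q \<noteq> \<alpha>" "q \<noteq> \<beta>"
      using y(1) by auto
    note y_emb = emb_In[OF q(2,3), of i a' b', symmetric]
    show ?thesis
    proof (cases "p = q")
      case False
      \<comment> \<open>Both copies of the gadget receive the same colouring, so separating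
        \<open>p\<close> from \<open>q\<close> also works across different edges.\<close>
      then obtain f where f: "cut i f" "f p = True" "f q = (\<not> True)"
        using sepE[OF i(1) p(1) q(1)] by metis
      show ?thesis
      proof (cases "f \<alpha> = f \<beta>")
        case True
        show ?thesis
          using Cut_loc[OF f(1) True] f(2,3) unfolding x y'(1) y_emb
          by (intro exI[of _ "loc i f"]) (simp add: loc_emb[OF True])
      next
        case False
        obtain \<gamma> where \<gamma>: "\<gamma> 0 \<noteq> \<gamma> n" "flips \<gamma> i" by (rule flips_exists[OF i(1)])
        obtain \<psi> where \<psi>: "good \<gamma> \<psi>" using good_exists by blast
        obtain f' where f': "cut i f'" "f' \<alpha> = src \<gamma> i" "f' \<beta> = (\<not> src \<gamma> i)"
          "\<forall>x y. (f' x = f' y) = (f x = f y)"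
          by (rule orient[OF f(1) False, of "src \<gamma> i"])
        note good = good_upd[OF \<psi> f'(1-3)]
        show ?thesis
          using Cut_good[OF \<gamma>(1) good] f(2,3) f'(4)[rule_format, of p q] unfolding x y'(1) y_emb
          by (intro exI[of _ "ext (sk \<gamma>) (\<psi>(i := f'))"])
            (simp add: good_flip[OF \<gamma>(1) good \<gamma>(2) i(1)] i(2) y'(2))
      qed
    next
      case True
      then have ne: "(a, b) \<noteq> (a', b')" using y(2) y'(1) by auto
      then have "i \<noteq> 0" using i(2) y'(2) by (auto simp: edges_def split: if_splits)
      \<comment> \<open>The same inner vertex in two copies: a colouring whose only change on the
        path is at \<open>k \<noteq> i\<close> makes both copies monochromatic, in opposite
        colours.\<close>
      define k :: nat where "k = (if i = 1 then 2 else 1)"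
      define \<gamma> where "\<gamma> = (\<lambda>x. k \<le> x)"
      have k: "0 < k" "k \<le> n" "k \<noteq> i" using n3 by (auto simp: k_def)
      then have \<gamma>: "\<gamma> 0 \<noteq> \<gamma> n" by (simp add: \<gamma>_def)
      have eq: "\<gamma> (i - 1) = \<gamma> i" using k by (auto simp: \<gamma>_def)
      then have nf: "\<not> flips \<gamma> i" using \<open>i \<noteq> 0\<close> by (simp add: flips_def)
      obtain \<psi> where \<psi>: "good \<gamma> \<psi>" using good_exists by blast
      have "sk \<gamma> (i - 1) = \<gamma> i" "sk \<gamma> (n + i) = (\<not> \<gamma> i)"
        using eq i(1) \<open>i \<noteq> 0\<close> by (auto simp: sk_def)
      moreover have "a = i - 1 \<and> a' = n + i \<or> a = n + i \<and> a' = i - 1"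
        using ne i(2) y'(2) \<open>i \<noteq> 0\<close> by (auto simp: edges_def split: if_splits)
      ultimately have "sk \<gamma> a \<noteq> sk \<gamma> a'" by metis
      then show ?thesis
        using Cut_good[OF \<gamma> \<psi>] unfolding x y'(1) y_emb
        by (intro exI[of _ "ext (sk \<gamma>) \<psi>"])
          (simp add: good_const[OF \<gamma> nf i(1)] i(2) y'(2))
    qed
  next
    case False
    from i(1) p show ?thesis
    proof (cases rule: control)
      case (1 f)
      have "loc i f y = f \<alpha>" using False by (auto simp: loc_def split: vertex.split)
      moreover have "loc i f (In i a b p) = f p" by (simp add: loc_def)
      ultimately show ?thesis using Cut_loc[OF 1(1,2)] 1(3) by metis
    next
      case 2
      obtain \<gamma> where \<gamma>: "\<gamma> 0 \<noteq> \<gamma> n" "flips \<gamma> i" by (rule flips_exists[OF i(1)])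
      obtain \<psi> where \<psi>: "good \<gamma> \<psi>" using good_exists by blast
      \<comment> \<open>The colour of \<open>y\<close> does not depend on the colouring chosen for
        label \<open>i\<close>, so \<open>p\<close> can be given the opposite one.\<close>
      obtain f where f: "cut i f" "f \<alpha> = src \<gamma> i" "f \<beta> = (\<not> src \<gamma> i)"
        "f p = (\<not> ext (sk \<gamma>) \<psi> y)"
        using 2[of "src \<gamma> i"] by metis
      note good = good_upd[OF \<psi> f(1-3)]
      have "ext (sk \<gamma>) (\<psi>(i := f)) y = ext (sk \<gamma>) \<psi> y"
        using False by (auto simp: ext_def split: vertex.split)
      moreover have "ext (sk \<gamma>) (\<psi>(i := f)) (In i a b p) = f p"
        unfolding x by (simp add: good_flip[OF \<gamma>(1) good \<gamma>(2) i])
      ultimately show ?thesis using Cut_good[OF \<gamma>(1) good] f(4) by metis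
    qed
  qed
qed

lemma verts_cases:
  assumes "x \<in> verts (Suc h)"
  obtains a where "x = V a" "a \<le> 2 * n"
  | i a b p where "x = In i a b p" "i \<le> n" "(a, b) \<in> edges i" "p \<in> verts h" "p \<noteq> \<alpha>" "p \<noteq> \<beta>"
proof -
  have "(\<exists>a. x = V a \<and> a \<le> 2 * n) \<or> (\<exists>i a b p. x = In i a b p \<and> i \<le> n \<and> (a, b) \<in> edges i \<and>
      p \<in> verts h \<and> p \<noteq> \<alpha> \<and> p \<noteq> \<beta>)"
    using assms by simp
  then show thesis using that by (elim disjE exE conjE) blast+
qed

lemma sep_Suc: "sep (verts (Suc h)) G"
  unfolding sep_def
proof (intro ballI impI)
  fix x y assume xy: "x \<in> verts (Suc h)" "y \<in> verts (Suc h)" "x \<noteq> y"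
  from xy(1) show "\<exists>F. Cut F \<and> F x \<noteq> F y"
  proof (cases rule: verts_cases)
    case x: (1 a)
    from xy(2) show ?thesis
    proof (cases rule: verts_cases)
      case y: (1 b)
      then have "a < b \<or> b < a" using xy(3) x by auto
      then show ?thesis using sep_V[of a b] sep_V[of b a] x y by metis
    next
      case y: (2 i a b p)
      then show ?thesis using sep_In[OF y(2-6) xy(1)] xy(3) by metis
    qed
  next
    case x: (2 i a b p)
    then show ?thesis using sep_In[OF x(2-6) xy(2)] xy(3) by metis
  qed
qed

section \<open>Separating a vertex from a domain\<close>

lemma dsep_lift:
  assumes i: "i \<le> n" and t: "t \<in> L i" and x: "x \<in> verts (Suc h)" "x \<notin> Domain (lift i t)"
  shows "\<exists>F c. Cut F \<and> (\<forall>z\<in>Domain (lift i t). F z = c) \<and> F x \<noteq> c"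
proof -
  have result: ?thesis
    if "Cut F" "\<And>e q. \<lbrakk>e \<in> edges i; q \<in> Domain t\<rbrakk> \<Longrightarrow> F (emb i e q) = (\<not> F x)" for F
  proof (intro exI conjI)
    show "\<forall>z\<in>Domain (lift i t). F z = (\<not> F x)"
    proof
      fix z assume "z \<in> Domain (lift i t)"
      then obtain e q where "e \<in> edges i" "q \<in> Domain t" "z = emb i e q"
        unfolding lift_def by blast
      then show "F z = (\<not> F x)" using that(2) by simp
    qed
  qed (use that in auto)
  have ne: "i \<noteq> i0" using t i0(3) by auto
  show ?thesis
  proof (cases "\<exists>e\<in>edges i. \<exists>p\<in>verts h. x = emb i e p")
    case True
    then obtain e p where e: "e \<in> edges i" "p \<in> verts h" "x = emb i e p" by blast
    have "p \<notin> Domain t" using x(2) e(1,3) unfolding lift_def by blast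
    then obtain f where f: "cut i f" "\<forall>x\<in>Domain t. f x = True" "f p = (\<not> True)"
      using dsepE[OF i t e(2)] by metis
    show ?thesis
    proof (cases "f \<alpha> = f \<beta>")
      case True
      show ?thesis
        using f(2,3)
        by (intro result[OF Cut_loc[OF f(1) True]]) (simp add: loc_emb[OF True] e(3))
    next
      case False
      obtain \<gamma> where \<gamma>: "\<gamma> 0 \<noteq> \<gamma> n" "flips \<gamma> i" by (rule flips_exists[OF i])
      obtain \<psi> where \<psi>: "good \<gamma> \<psi>" using good_exists by blast
      obtain f' where f': "cut i f'" "f' \<alpha> = src \<gamma> i" "f' \<beta> = (\<not> src \<gamma> i)"
        "\<forall>x y. (f' x = f' y) = (f x = f y)"
        by (rule orient[OF f(1) False, of "src \<gamma> i"])
      note good = good_upd[OF \<psi> f'(1-3)]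
      show ?thesis
      proof (rule result[OF Cut_good[OF \<gamma>(1) good]])
        fix e' q assume "e' \<in> edges i" "q \<in> Domain t"
        then show "ext (sk \<gamma>) (\<psi>(i := f')) (emb i e' q) = (\<not> ext (sk \<gamma>) (\<psi>(i := f')) x)"
          unfolding e(3) using f(2,3) f'(4)[rule_format, of q p] e(1)
          by (simp add: good_flip[OF \<gamma>(1) good \<gamma>(2) i])
      qed
    qed
  next
    case False
    from i t show ?thesis
    proof (cases rule: domain_control)
      case (1 f)
      have "loc i f x = f \<alpha>"
        using x(1)
      proof (cases rule: verts_cases)
        case (2 j a b p)
        then have "j \<noteq> i" using False emb_In[of p i a b] by metis
        then show ?thesis using 2 by (simp add: loc_def)
      qed (simp add: loc_def)
      then show ?thesis
        using 1(3) by (intro result[OF Cut_loc[OF 1(1,2)]]) (simp add: loc_emb[OF 1(2)])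
    next
      case s: (2 s)
      \<comment> \<open>The domain gets colour \<open>src \<gamma> i = s\<close>, so a skeleton
        colouring giving \<open>a\<close> the opposite colour suffices.\<close>
      have main: ?thesis if \<gamma>: "\<gamma> 0 \<noteq> \<gamma> n" "flips \<gamma> i" and a: "x = V a" "sk \<gamma> a = (src \<gamma> i \<noteq> s)" for \<gamma> a
      proof -
        obtain \<psi> where \<psi>: "good \<gamma> \<psi>" using good_exists by blast
        obtain f where f: "cut i f" "f \<alpha> = src \<gamma> i" "f \<beta> = (\<not> src \<gamma> i)"
          "\<forall>x\<in>Domain t. f x = (src \<gamma> i = s)"
          using s[of "src \<gamma> i"] by metis
        note good = good_upd[OF \<psi> f(1-3)]
        show ?thesis
          using f(4) a by (intro result[OF Cut_good[OF \<gamma>(1) good]])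
            (simp add: good_flip[OF \<gamma>(1) good \<gamma>(2) i])
      qed
      from x(1) show ?thesis
      proof (cases rule: verts_cases)
        case a: (1 a)
        have "x \<noteq> emb i e \<alpha>" "x \<noteq> emb i e \<beta>" if "e \<in> edges i" for e
          using False that ab_verts by metis+
        then have a': "a \<noteq> fst e" "a \<noteq> snd e" if "e \<in> edges i" for e
          using that a by auto
        \<comment> \<open>The first three cases cover all situations in which no
          \<open>sk \<gamma>\<close> gives \<open>a\<close> the required colour. There a cut at
          \<open>i0\<close> is used; as \<open>i \<noteq> i0\<close>, the edges of label
          \<open>i\<close> lie entirely on the side without \<open>a\<close>.\<close>
        consider "a = 0" "i = 0" "\<not> s" | "a = 0" "i = n" | "a = 2 * n" "i = 1" "s"
          | "i = 0" "\<not> (a = 0 \<and> \<not> s)"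
          | "0 < i" "\<not> (s \<and> a = 0 \<and> i = n)" "\<not> (s \<and> a = 2 * n \<and> i = 1)"
          by blast
        then show ?thesis
        proof cases
          case 1
          show ?thesis
          proof (rule result[OF Cut_start])
            fix e q assume "e \<in> edges i"
            then have "\<not> fst e < i0" "\<not> snd e < i0"
              using 1 i0(1,2) by (auto simp: edges_def)
            then show "ext (\<lambda>a. a < i0) undefined (emb i e q) = (\<not> ext (\<lambda>a. a < i0) undefined x)"
              using a(1) 1(1) i0(1) by (subst ext_emb_const) simp_all
          qed
        next
          case 2
          show ?thesis
          proof (rule result[OF Cut_start])
            fix e q assume "e \<in> edges i"
            then have "\<not> fst e < i0" "\<not> snd e < i0"
              using 2 i0(1,2) ne n3 by (auto simp: edges_def)
            then show "ext (\<lambda>a. a < i0) undefined (emb i e q) = (\<not> ext (\<lambda>a. a < i0) undefined x)"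
              using a(1) 2(1) i0(1) by (subst ext_emb_const) simp_all
          qed
        next
          case 3
          obtain f where f: "cut 0 f" "f \<alpha> = False" "f \<beta> = (\<not> False)"
            using sepE[OF _ ab_verts ab] by blast
          define \<psi> where "\<psi> = (\<lambda>j::nat. f)"
          have "Cut (ext (\<lambda>a. n + i0 \<le> a) \<psi>)" using f by (intro Cut_end) (simp_all add: \<psi>_def)
          then show ?thesis
          proof (rule result)
            fix e q assume "e \<in> edges i"
            then have "\<not> n + i0 \<le> fst e" "\<not> n + i0 \<le> snd e"
              using 3(2) i0(1,2) ne n3 by (auto simp: edges_def)
            then show "ext (\<lambda>a. n + i0 \<le> a) \<psi> (emb i e q) = (\<not> ext (\<lambda>a. n + i0 \<le> a) \<psi> x)"
              using a(1) 3(1) i0(2) by (subst ext_emb_const) simp_all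
          qed
        next
          case 4
          have "a \<noteq> n" "a \<noteq> 2 * n" using a'[of "(n, 2 * n)"] 4(1) by (simp_all add: edges_def)
          from colour_vertex[OF a(2) this 4(2)]
          obtain \<gamma> where "\<gamma> 0 \<noteq> \<gamma> n" "sk \<gamma> a = (\<gamma> n \<noteq> s)" unfolding sk_def .
          then show ?thesis using 4(1) a(1) by (intro main[of \<gamma> a]) (simp_all add: flips_def src_def)
        next
          case 5
          have "a \<notin> {i - 1, i, n + i, n + i - 1}"
            using a'[of "(i - 1, i)"] a'[of "(n + i, n + i - 1)"] 5(1) by (simp add: edges_def)
          from colour_label_vertex[OF 5(1) i a(2) this 5(2,3)]
          obtain \<gamma> where "\<gamma> 0 \<noteq> \<gamma> n" "\<gamma> (i - 1) \<noteq> \<gamma> i" "sk \<gamma> a = (if s then \<gamma> i else \<gamma> (i - 1))"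
            unfolding sk_def .
          then show ?thesis using 5(1) a(1)
            by (intro main[of \<gamma> a]) (auto simp: flips_def src_def)
        qed
      next
        case x': (2 j a b p)
        then have "j \<noteq> i" using False emb_In[of p i a b] by metis
        from x'(2,4-6) show ?thesis
        proof (cases rule: control)
          case (1 f)
          have "loc j f x = f p" using x'(1) by (simp add: loc_def)
          then show ?thesis
            using 1(3) \<open>j \<noteq> i\<close> by (intro result[OF Cut_loc[OF 1(1,2)]]) (auto simp: loc_emb[OF 1(2)])
        next
          case 2
          \<comment> \<open>Both labels must change colour, so that \<open>f\<close> determines the
            colour of the domain and \<open>f'\<close> gives \<open>p\<close> the opposite
            one.\<close>
          obtain \<gamma> where \<gamma>: "\<gamma> 0 \<noteq> \<gamma> n" "flips \<gamma> i" "flips \<gamma> j"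
          proof -
            consider "i = 0" | "j = 0" | "0 < i" "0 < j" by blast
            then show thesis
            proof cases
              case 1
              obtain \<gamma> where "\<gamma> 0 \<noteq> \<gamma> n" "flips \<gamma> j" by (rule flips_exists[OF x'(2)])
              then show ?thesis using 1 by (intro that[of \<gamma>]) (simp_all add: flips_def)
            next
              case 2
              obtain \<gamma> where "\<gamma> 0 \<noteq> \<gamma> n" "flips \<gamma> i" by (rule flips_exists[OF i])
              then show ?thesis using 2 by (intro that[of \<gamma>]) (simp_all add: flips_def)
            next
              case 3
              from colour_two_labels[OF \<open>j \<noteq> i\<close>[symmetric] 3(1) i 3(2) x'(2)]
              obtain \<gamma> :: "nat \<Rightarrow> bool" where
                "\<gamma> 0 \<noteq> \<gamma> n" "\<gamma> (i - 1) \<noteq> \<gamma> i" "\<gamma> (j - 1) \<noteq> \<gamma> j" .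
              then show ?thesis by (intro that[of \<gamma>]) (simp_all add: flips_def)
            qed
          qed
          obtain \<psi> where \<psi>: "good \<gamma> \<psi>" using good_exists by blast
          obtain f where f: "cut i f" "f \<alpha> = src \<gamma> i" "f \<beta> = (\<not> src \<gamma> i)"
            "\<forall>x\<in>Domain t. f x = (src \<gamma> i = s)"
            using s[of "src \<gamma> i"] by metis
          obtain f' where f': "cut j f'" "f' \<alpha> = src \<gamma> j" "f' \<beta> = (\<not> src \<gamma> j)"
            "f' p = (src \<gamma> i \<noteq> s)"
            using 2[of "src \<gamma> j"] by metis
          note good = good_upd[OF good_upd[OF \<psi> f(1-3)] f'(1-3)]
          have "ext (sk \<gamma>) (\<psi>(i := f, j := f')) x = f' p"
            using good_flip[OF \<gamma>(1) good \<gamma>(3) x'(2,3), of p] emb_In[OF x'(5,6)] x'(1) by simp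
          then show ?thesis
            using f(4) f'(4) \<open>j \<noteq> i\<close>
            by (intro result[OF Cut_good[OF \<gamma>(1) good]])
              (simp add: good_flip[OF \<gamma>(1) good \<gamma>(2) i])
        qed
      qed
    qed
  qed
qed

lemma dsep_Suc: "dsep (verts (Suc h)) G"
  unfolding dsep_def
proof (intro ballI)
  fix r x assume r: "r \<in> G" and x: "x \<in> verts (Suc h) - Domain r"
  from G_cases[OF r] show "\<exists>F c. Cut F \<and> (\<forall>z\<in>Domain r. F z = c) \<and> F x \<noteq> c"
  proof (elim disjE bexE exE conjE)
    fix p q assume p: "p \<in> verts (Suc h)" "r = {(p, q)}"
    then obtain F where "Cut F" "F x \<noteq> F p" using sep_Suc x unfolding sep_def by blast
    then show ?thesis using p(2) by (intro exI[of _ F] exI[of _ "F p"]) simp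
  next
    fix i t assume "i \<le> n" "t \<in> L i" "r = lift i t"
    then show ?thesis using dsep_lift x by blast
  qed
qed

end

text \<open>Induction on the level. As \<open>lift i\<close> is injective, \<open>L i\<close> is no
  larger than \<open>G\<close> and the induction hypothesis applies to it; by pigeonhole one of the
  labels from 1 to \<open>n\<close> carries no map of \<open>G\<close>.\<close>

lemma (in skeleton) separation:
  assumes "finite G" "card G < n" "G \<subseteq> pmaps h" "{} \<notin> G"
  shows "sep (verts h) G \<and> dsep (verts h) G"
  using assms
proof (induction h arbitrary: G)
  case 0
  have adm: "\<forall>r\<in>G. adm (\<lambda>x. x = \<alpha>) r" using 0 by (auto simp: adm_single)
  have "sep (verts 0) G"
    unfolding sep_def
  proof (intro ballI impI)
    fix p q assume "p \<in> verts 0" "q \<in> verts 0" "p \<noteq> q"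
    then have "(p = \<alpha>) \<noteq> (q = \<alpha>)" by auto
    then show "\<exists>f. (\<forall>r\<in>G. adm f r) \<and> f p \<noteq> f q" using adm by (intro exI[of _ "\<lambda>x. x = \<alpha>"]) simp
  qed
  moreover have "dsep (verts 0) G"
    unfolding dsep_def
  proof (intro ballI)
    fix r p assume "r \<in> G" "p \<in> verts 0 - Domain r"
    moreover from this have "r = {(\<alpha>, \<beta>)}" using 0 by auto
    ultimately have "p = \<beta>" "Domain r = {\<alpha>}" by auto
    then show "\<exists>f c. (\<forall>r\<in>G. adm f r) \<and> (\<forall>x\<in>Domain r. f x = c) \<and> f p \<noteq> c"
      using adm ab by (intro exI[of _ "\<lambda>x. x = \<alpha>"] exI[of _ True]) auto
  qed
  ultimately show ?case ..
next
  case (Suc h)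
  define L where "L i = {t \<in> pmaps h. t \<noteq> {} \<and> lift i t \<in> G}" for i
  have L_G: "lift i ` L i \<subseteq> G" and L_T: "L i \<subseteq> pmaps h" and L_ne: "{} \<notin> L i" for i
    by (auto simp: L_def)
  have "inj_on (lift i) (L i)" if "i \<le> n" for i
    using lift_inj[OF _ that] by (intro inj_onI) blast
  then have L_fin: "finite (L i)" and "card (L i) \<le> card G" if "i \<le> n" for i
    using L_G[of i] Suc.prems(1) that by (blast intro: inj_on_finite card_inj_on_le)+
  then have IH: "sep (verts h) (L i) \<and> dsep (verts h) (L i)" if "i \<le> n" for i
    using Suc.IH[OF L_fin[OF that] _ L_T L_ne] Suc.prems(2) that by (meson le_less_trans)
  have "\<exists>i\<in>{1..n}. L i = {}"
  proof (rule ccontr)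
    assume "\<not> (\<exists>i\<in>{1..n}. L i = {})"
    then have "\<forall>i\<in>{1..n}. \<exists>t. t \<in> L i" by blast
    then obtain t where t: "\<And>i. i \<in> {1..n} \<Longrightarrow> t i \<in> L i" by metis
    \<comment> \<open>A nonempty lift has pairs on both edges of its label, whereas lifts of
      different labels have at most one range value on their common pairs.\<close>
    have "inj_on (\<lambda>i. lift i (t i)) {1..n}"
    proof (rule inj_onI, rule ccontr)
      fix i j assume ij: "i \<in> {1..n}" "j \<in> {1..n}" "lift i (t i) = lift j (t j)" "i \<noteq> j"
      have T: "t i \<in> pmaps h" "t j \<in> pmaps h" and "t i \<noteq> {}"
        using t ij(1,2) by (auto simp: L_def)
      from \<open>t i \<noteq> {}\<close> obtain p q where pq: "(p, q) \<in> t i" by auto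
      have e: "(i - 1, i) \<in> edges i" "(n + i, n + i - 1) \<in> edges i"
        using ij(1) by (auto simp: edges_def)
      have "(emb i e p, emb i e q) \<in> lift i (t i) \<inter> lift j (t j)" if "e \<in> edges i" for e
        using ij(3) pq that unfolding lift_def by blast
      from lift_inter_single[OF ij(4) _ _ T this[OF e(1)] this[OF e(2)]]
      have "emb i (i - 1, i) q = emb i (n + i, n + i - 1) q" using ij(1,2) by simp
      from emb_inj[OF this e] ij(1) have "i - 1 = n + i" by simp
      then show False using n3 by linarith
    qed
    moreover have "(\<lambda>i. lift i (t i)) ` {1..n} \<subseteq> G" using t by (auto simp: L_def)
    ultimately have "card {1..n} \<le> card G" using Suc.prems(1) by (rule card_inj_on_le)
    then show False using Suc.prems(2) by simp
  qed
  then obtain i0 where i0: "0 < i0" "i0 \<le> n" "L i0 = {}" by (auto simp: Suc_le_eq)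
  interpret composite n h G L i0
  proof
    fix r assume r: "r \<in> G"
    then have "r \<in> pmaps (Suc h)" "r \<noteq> {}" using Suc.prems(3,4) by auto
    from this(1) show "(\<exists>p\<in>verts (Suc h). \<exists>q. r = {(p, q)}) \<or> (\<exists>i\<le>n. \<exists>t\<in>L i. r = lift i t)"
    proof (cases rule: pmaps_cases)
      case (1 p q)
      then have "r = {(p, q)}" using \<open>r \<noteq> {}\<close> by blast
      then show ?thesis using 1(1) by blast
    next
      case (2 i t)
      then have "t \<noteq> {}" using \<open>r \<noteq> {}\<close> by (auto simp: lift_def)
      then have "t \<in> L i" using 2 r by (simp add: L_def)
      then show ?thesis using 2 by blast
    qed
  qed (use IH i0 L_T L_ne in blast)+
  show ?case using sep_Suc dsep_Suc by blast
qed

section \<open>Identities of \<open>B\<^sub>2\<^sup>1\<close> in few variables\<close>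

primrec vars :: "trm \<Rightarrow> nat set" where
  "vars (Var x) = {x}"
| "vars (Add s t) = vars s \<union> vars t"
| "vars (Mul s t) = vars s \<union> vars t"

lemma finite_vars: "finite (vars t)"
  by (induction t) auto

lemma eval_cong: "(\<And>x. x \<in> vars t \<Longrightarrow> \<phi> x = \<psi> x) \<Longrightarrow> eval a m \<phi> t = eval a m \<psi> t"
  by (induction t) auto

abbreviation reval :: "(nat \<Rightarrow> ('a \<times> 'a) set) \<Rightarrow> trm \<Rightarrow> ('a \<times> 'a) set" where
  "reval \<equiv> eval (\<inter>) (O)"

text \<open>All partial injections of a two-point set except the transposition; they correspond to
  the six matrices of \<open>B21\<close>.\<close>

definition BR :: "(bool \<times> bool) set set" where
  "BR = {r. r \<subseteq> Id \<or> (\<exists>a. r \<subseteq> {(a, \<not> a)})}"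

definition mat_of :: "(bool \<times> bool) set \<Rightarrow> int^2^2" where
  "mat_of r = (\<chi> i j. if (i = 1, j = 1) \<in> r then 1 else 0)"

lemma mat_of_B21:
  assumes "r \<in> BR"
  shows "mat_of r \<in> B21"
proof -
  from assms consider "r \<subseteq> Id" | a where "r \<subseteq> {(a, \<not> a)}" by (auto simp: BR_def)
  then show ?thesis
  proof cases
    case 1
    then have "(True, False) \<notin> r" "(False, True) \<notin> r" by auto
    then show ?thesis
      by (cases "(True, True) \<in> r"; cases "(False, False) \<in> r")
        (simp_all add: mat_of_def B21_def vec_eq_iff forall_2)
  next
    case (2 a)
    then have "r = {} \<or> r = {(a, \<not> a)}" by blast
    then show ?thesis
      by (cases a) (elim disjE; simp add: mat_of_def B21_def vec_eq_iff forall_2)+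
  qed
qed

lemma mat_of_inj:
  assumes "mat_of r = mat_of s"
  shows "r = s"
proof -
  have "(i = 1, j = 1) \<in> r \<longleftrightarrow> (i = 1, j = 1) \<in> s" for i j :: 2
  proof -
    have "mat_of r $ i $ j = mat_of s $ i $ j" using assms by simp
    then show ?thesis by (simp add: mat_of_def split: if_splits)
  qed
  from this[of 1 1] this[of 1 2] this[of 2 1] this[of 2 2]
  have "(x, y) \<in> r \<longleftrightarrow> (x, y) \<in> s" for x y
    by (cases x; cases y) simp_all
  then show "r = s" by (intro equalityI subrelI) simp_all
qed

lemma BR_closed:
  assumes "r \<in> BR" "s \<in> BR"
  shows "r \<inter> s \<in> BR" "r O s \<in> BR"
proof -
  show "r \<inter> s \<in> BR" using assms(1) unfolding BR_def by blast
  from assms(1) consider "r \<subseteq> Id" | a where "r \<subseteq> {(a, \<not> a)}" by (auto simp: BR_def)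
  then show "r O s \<in> BR"
  proof cases
    case 1
    then have "r O s \<subseteq> s" by auto
    then show ?thesis using assms(2) unfolding BR_def by blast
  next
    case (2 a)
    from assms(2) consider "s \<subseteq> Id" | b where "s \<subseteq> {(b, \<not> b)}" by (auto simp: BR_def)
    then show ?thesis
    proof cases
      case 1
      then have "r O s \<subseteq> {(a, \<not> a)}" using 2 by auto
      then show ?thesis unfolding BR_def by blast
    next
      case (2 b)
      with \<open>r \<subseteq> {(a, \<not> a)}\<close> have "r O s \<subseteq> Id" by auto
      then show ?thesis unfolding BR_def by blast
    qed
  qed
qed

lemma BR_sv: "r \<in> BR \<Longrightarrow> single_valued r"
  unfolding BR_def single_valued_def by auto

lemma mat_of_inter: "\<lbrakk>r \<in> BR; s \<in> BR\<rbrakk> \<Longrightarrow> mat_of (r \<inter> s) = nat_add (mat_of r) (mat_of s)"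
  by (subst nat_add_eq_entrywise) (simp_all add: mat_of_B21, simp add: mat_of_def vec_eq_iff)

lemma mat_of_relcomp:
  assumes "r \<in> BR" "s \<in> BR"
  shows "mat_of (r O s) = mat_of r ** mat_of s"
proof -
  have rel: "(x, z) \<in> r O s \<longleftrightarrow> (x, True) \<in> r \<and> (True, z) \<in> s \<or> (x, False) \<in> r \<and> (False, z) \<in> s" for x z
    by (auto simp: relcomp_unfold ex_bool_eq)
  have "\<not> ((x, True) \<in> r \<and> (x, False) \<in> r)" for x
    using BR_sv[OF assms(1)] by (auto dest: single_valuedD)
  then show ?thesis
    by (auto simp: mat_of_def vec_eq_iff matrix_matrix_mult_def sum_2 rel)
qed

lemma BR_eval:
  assumes "\<And>x. b x \<in> BR"
  shows "reval b t \<in> BR \<and> mat_of (reval b t) = eval nat_add (**) (\<lambda>x. mat_of (b x)) t"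
proof (induction t)
  case (Add s t)
  then show ?case using BR_closed[of "reval b s" "reval b t"] mat_of_inter[of "reval b s" "reval b t"]
    by simp
next
  case (Mul s t)
  then show ?case using BR_closed[of "reval b s" "reval b t"] mat_of_relcomp[of "reval b s" "reval b t"]
    by simp
qed (use assms in simp)

lemma B21_reval:
  assumes "satisfies B21 nat_add (**) (s, t)" "\<And>x. b x \<in> BR"
  shows "reval b s = reval b t"
proof (rule mat_of_inj)
  show "mat_of (reval b s) = mat_of (reval b t)"
    using assms BR_eval[of b, OF assms(2)] mat_of_B21 unfolding satisfies_def by auto
qed

lemma reval_empty: "\<lbrakk>x \<in> vars t; b x = {}\<rbrakk> \<Longrightarrow> reval b t = {}"
  by (induction t) auto

lemma reval_Id: "(\<And>x. x \<in> vars t \<Longrightarrow> b x = Id) \<Longrightarrow> reval b t = Id"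
  by (induction t) auto

lemma B21_vars:
  assumes "satisfies B21 nat_add (**) (s, t)"
  shows "vars t \<subseteq> vars s"
proof (rule subsetI, rule ccontr)
  fix y assume y: "y \<in> vars t" "y \<notin> vars s"
  \<comment> \<open>The zero matrix for \<open>y\<close> and the identity matrix elsewhere: exactly
    the terms containing \<open>y\<close> evaluate to zero.\<close>
  define b :: "nat \<Rightarrow> (bool \<times> bool) set" where "b x = (if x = y then {} else Id)" for x
  have "b x \<in> BR" for x by (simp add: b_def BR_def)
  then have "reval b s = reval b t" by (rule B21_reval[OF assms])
  moreover have "reval b t = {}" using y(1) by (rule reval_empty) (simp add: b_def)
  moreover have "reval b s = Id" using y(2) by (intro reval_Id) (auto simp: b_def)
  ultimately show False by auto
qed

section \<open>Transfer along admissible colourings\<close>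

lemma adm_BR:
  assumes "adm f r"
  shows "map_prod f f ` r \<in> BR"
  using assms unfolding adm_def
proof
  assume "\<forall>(p, q)\<in>r. f p = f q"
  then have "map_prod f f ` r \<subseteq> Id" by auto
  then show ?thesis by (simp add: BR_def)
next
  assume "\<exists>c. \<forall>(p, q)\<in>r. f p = c \<and> f q = (\<not> c)"
  then obtain c where "\<And>p q. (p, q) \<in> r \<Longrightarrow> f p = c \<and> f q = (\<not> c)" by auto
  then have "map_prod f f ` r \<subseteq> {(c, \<not> c)}" by auto
  then show ?thesis unfolding BR_def by blast
qed

text \<open>Only this inclusion holds in general, since merging points may create new products and
  intersections; \<open>sep\<close> and \<open>dsep\<close> are what allows a return.\<close>

lemma reval_image: "(p, q) \<in> reval \<phi> t \<Longrightarrow> (f p, f q) \<in> reval (\<lambda>x. map_prod f f ` \<phi> x) t"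
proof (induction t arbitrary: p q)
  case (Mul s t)
  then obtain r where "(p, r) \<in> reval \<phi> s" "(r, q) \<in> reval \<phi> t" by auto
  then show ?case using relcompI[OF Mul.IH(1) Mul.IH(2)] by simp
qed auto

lemma reval_BR: "(\<And>x. x \<in> vars t \<Longrightarrow> b x \<in> BR) \<Longrightarrow> reval b t \<in> BR"
  by (induction t) (simp_all add: BR_closed)

lemma reval_sub: "(\<And>x. x \<in> vars t \<Longrightarrow> \<phi> x \<subseteq> X \<times> X) \<Longrightarrow> reval \<phi> t \<subseteq> X \<times> X"
proof (induction t)
  case (Add s t)
  then show ?case by simp blast
next
  case (Mul s t)
  then have "reval \<phi> s \<subseteq> X \<times> X" "reval \<phi> t \<subseteq> X \<times> X" by simp_all
  then show ?case by auto
qed simp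

text \<open>Variables are settled by \<open>dsep\<close>. For a sum, a colouring separating the two
  values reached from \<open>p\<close> would contradict single-valuedness of the image. For a
  product, single-valuedness forces the intermediate colour to be that of the intermediate point, so
  the hypothesis passes on to it.\<close>

lemma reval_domain:
  assumes X: "sep X G" "dsep X G"
    and "\<And>x. x \<in> vars t \<Longrightarrow> \<phi> x \<in> G \<and> \<phi> x \<subseteq> X \<times> X"
    and "p \<in> X"
    and "\<And>f. \<forall>r\<in>G. adm f r \<Longrightarrow> f p \<in> Domain (reval (\<lambda>x. map_prod f f ` \<phi> x) t)"
  shows "p \<in> Domain (reval \<phi> t)"
  using assms(3-)
proof (induction t arbitrary: p)
  case (Var x)
  show ?case
  proof (rule ccontr)
    assume "p \<notin> Domain (reval \<phi> (Var x))"
    then have p: "p \<in> X - Domain (\<phi> x)" "\<phi> x \<in> G" using Var by auto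
    from X(2)[unfolded dsep_def, THEN bspec, OF p(2), THEN bspec, OF p(1)]
    obtain f c where f: "\<forall>r\<in>G. adm f r" "\<forall>x\<in>Domain (\<phi> x). f x = c" "f p \<noteq> c"
      by (elim exE conjE)
    from Var(3)[OF f(1)] show False using f(2,3) by auto
  qed
next
  case (Add s t)
  have dom: "f p \<in> Domain (reval (\<lambda>x. map_prod f f ` \<phi> x) s)"
    "f p \<in> Domain (reval (\<lambda>x. map_prod f f ` \<phi> x) t)" if "\<forall>r\<in>G. adm f r" for f
    using Add.prems(3)[OF that] by auto
  obtain q where q: "(p, q) \<in> reval \<phi> s"
    using Add.IH(1)[OF _ Add.prems(2) dom(1)] Add.prems(1) by auto
  obtain r where r: "(p, r) \<in> reval \<phi> t"
    using Add.IH(2)[OF _ Add.prems(2) dom(2)] Add.prems(1) by auto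
  have "q = r"
  proof (rule ccontr)
    assume "q \<noteq> r"
    moreover have "q \<in> X" "r \<in> X"
      using q r reval_sub[of s \<phi> X] reval_sub[of t \<phi> X] Add.prems(1) by auto
    ultimately obtain f where f: "\<forall>r\<in>G. adm f r" "f q \<noteq> f r"
      using X(1) unfolding sep_def by metis
    let ?b = "\<lambda>x. map_prod f f ` \<phi> x"
    have BR: "?b x \<in> BR" if "x \<in> vars (Add s t)" for x
      using Add.prems(1)[OF that] f(1) adm_BR by blast
    then have sv: "single_valued (reval ?b s)" "single_valued (reval ?b t)"
      by (intro BR_sv reval_BR; simp)+
    obtain c where "(f p, c) \<in> reval ?b s" "(f p, c) \<in> reval ?b t"
      using Add.prems(3)[OF f(1)] by auto
    then show False
      using reval_image[OF q, of f] reval_image[OF r, of f] sv f(2) by (metis single_valuedD)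
  qed
  then show ?case using q r by auto
next
  case (Mul s t)
  have "f p \<in> Domain (reval (\<lambda>x. map_prod f f ` \<phi> x) s)" if "\<forall>r\<in>G. adm f r" for f
    using Mul.prems(3)[OF that] by auto
  then obtain q where q: "(p, q) \<in> reval \<phi> s"
    using Mul.IH(1)[OF _ Mul.prems(2)] Mul.prems(1) by auto
  then have qX: "q \<in> X" using reval_sub[of s \<phi> X] Mul.prems(1) by auto
  have "f q \<in> Domain (reval (\<lambda>x. map_prod f f ` \<phi> x) t)" if f: "\<forall>r\<in>G. adm f r" for f
  proof -
    let ?b = "\<lambda>x. map_prod f f ` \<phi> x"
    have "?b x \<in> BR" if "x \<in> vars (Mul s t)" for x
      using Mul.prems(1)[OF that] f adm_BR by blast
    then have sv: "single_valued (reval ?b s)" by (intro BR_sv reval_BR) simp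
    obtain c d where "(f p, c) \<in> reval ?b s" "(c, d) \<in> reval ?b t"
      using Mul.prems(3)[OF f] by auto
    moreover from this have "c = f q" using reval_image[OF q, of f] sv by (metis single_valuedD)
    ultimately show ?thesis by auto
  qed
  then obtain r where "(q, r) \<in> reval \<phi> t"
    using Mul.IH(2)[OF _ qX] Mul.prems(1) by auto
  then show ?case using q by auto
qed

lemma (in skeleton) pmaps_satisfies_sub:
  assumes B: "satisfies B21 nat_add (**) (s, t)" "satisfies B21 nat_add (**) (t, s)"
    and small: "card (vars s) < n" and \<phi>: "\<And>x. \<phi> x \<in> pmaps h"
  shows "reval \<phi> s \<subseteq> reval \<phi> t"
proof (rule subrelI)
  fix p q assume pq: "(p, q) \<in> reval \<phi> s"
  define G where "G = \<phi> ` vars s"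
  have vars: "vars t = vars s" using B21_vars[OF B(1)] B21_vars[OF B(2)] by blast
  have "card G < n"
    using card_image_le[OF finite_vars, of \<phi> s] small by (simp add: G_def)
  \<comment> \<open>An empty relation would make the value of \<open>s\<close> empty, but it
    contains \<open>(p, q)\<close>.\<close>
  moreover have "{} \<notin> G"
  proof
    assume "{} \<in> G"
    then obtain x where "x \<in> vars s" "\<phi> x = {}" by (auto simp: G_def)
    then show False using reval_empty pq by blast
  qed
  moreover have "finite G" "G \<subseteq> pmaps h" using finite_vars \<phi> by (auto simp: G_def)
  ultimately have sep: "sep (verts h) G" "dsep (verts h) G" using separation by blast+
  have sub: "\<phi> x \<subseteq> verts h \<times> verts h" for x using pmaps_sub[OF \<phi>] by blast
  have Q: "reval \<phi> u \<subseteq> verts h \<times> verts h" for u by (rule reval_sub) (rule sub)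
  have cut: "(f p, f q) \<in> reval (\<lambda>x. map_prod f f ` \<phi> x) t \<and>
      single_valued (reval (\<lambda>x. map_prod f f ` \<phi> x) t)" if f: "\<forall>r\<in>G. adm f r" for f
  proof -
    \<comment> \<open>Only variables of \<open>s\<close> have images known to be in
      \<open>BR\<close>; the default \<open>{}\<close> yields an assignment into \<open>BR\<close>
      everywhere.\<close>
    define b where "b x = (if x \<in> vars s then map_prod f f ` \<phi> x else {})" for x
    have b: "b x \<in> BR" for x using f adm_BR by (auto simp: b_def G_def) (simp add: BR_def)
    have eq: "reval (\<lambda>x. map_prod f f ` \<phi> x) u = reval b u" if "vars u = vars s" for u
      by (rule eval_cong) (simp add: b_def that)
    have "(f p, f q) \<in> reval b s" using reval_image[OF pq, of f] eq[of s] by simp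
    moreover have "reval b s = reval b t" by (rule B21_reval[OF B(1)]) (rule b)
    moreover have "single_valued (reval b t)" by (intro BR_sv reval_BR b)
    ultimately show ?thesis unfolding eq[OF vars] by simp
  qed
  have "p \<in> Domain (reval \<phi> t)"
  proof (rule reval_domain[OF sep])
    show "\<phi> x \<in> G \<and> \<phi> x \<subseteq> verts h \<times> verts h" if "x \<in> vars t" for x
      using that sub vars by (simp add: G_def)
    show "p \<in> verts h" using pq Q by blast
    show "f p \<in> Domain (reval (\<lambda>x. map_prod f f ` \<phi> x) t)" if "\<forall>r\<in>G. adm f r" for f
      using cut[OF that] by blast
  qed
  then obtain r where r: "(p, r) \<in> reval \<phi> t" by blast
  have "q = r"
  proof (rule ccontr)
    assume "q \<noteq> r"
    moreover have "q \<in> verts h" "r \<in> verts h" using pq r Q by blast+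
    ultimately obtain f where f: "\<forall>r\<in>G. adm f r" "f q \<noteq> f r"
      using sep(1) unfolding sep_def by metis
    then show False using cut[OF f(1)] reval_image[OF r, of f] by (metis single_valuedD)
  qed
  then show "(p, q) \<in> reval \<phi> t" using r by simp
qed

lemma (in skeleton) pmaps_satisfies:
  assumes "satisfies B21 nat_add (**) (s, t)" "card (vars s) < n" "card (vars t) < n"
  shows "satisfies (pmaps h) (\<inter>) (O) (s, t)"
proof -
  have "satisfies B21 nat_add (**) (t, s)" using assms(1) by (simp add: satisfies_def)
  note sub = pmaps_satisfies_sub[OF assms(1) this assms(2)] pmaps_satisfies_sub[OF this assms(1) assms(3)]
  show ?thesis
    unfolding satisfies_def fst_conv snd_conv by (intro allI impI equalityI sub; blast)
qed

section \<open>Walks labelled by the words $v_{n,m}^{(h)}$\<close>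

definition path :: "('v \<Rightarrow> ('a \<times> 'a) set) \<Rightarrow> 'v list \<Rightarrow> ('a \<times> 'a) set" where
  "path \<rho> w = foldr (\<lambda>x r. \<rho> x O r) w Id"

lemma path_simps [simp]: "path \<rho> [] = Id" "path \<rho> (x # w) = \<rho> x O path \<rho> w"
  by (simp_all add: path_def)

lemma path_append [simp]: "path \<rho> (u @ v) = path \<rho> u O path \<rho> v"
  by (induction u) (simp_all add: O_assoc)

lemma word_eval_path: "w \<noteq> [] \<Longrightarrow> word_eval (O) \<rho> w = path \<rho> w"
  by (induction w rule: induct_list012) simp_all

lemma path_concat_loop: "(\<And>i. i \<in> set is \<Longrightarrow> (p, p) \<in> path \<rho> (B i)) \<Longrightarrow> (p, p) \<in> path \<rho> (concat (map B is))"
  by (induction "is") (auto intro: relcompI)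

lemma path_pow: "(p, p) \<in> path \<rho> w \<Longrightarrow> (p, p) \<in> path \<rho> (word_pow w k)"
  by (induction k) (auto simp: word_pow_def intro: relcompI)

text \<open>Starting from the one-letter word with empty index makes level 1 an instance of the
  general recursion.\<close>

primrec v_word0 :: "nat \<Rightarrow> nat \<Rightarrow> nat \<Rightarrow> nat list list" where
  "v_word0 n m 0 = [[]]"
| "v_word0 n m (Suc h) = v_pattern n m (\<lambda>j. map (\<lambda>is. is @ [j]) (v_word0 n m h))"

lemma v_word_eq: "v_word n m (Suc h) = v_word0 n m (Suc h)"
  by (induction h) simp_all

context skeleton
begin

text \<open>The last index was appended by the outermost recursion step, so it selects the edge
  label and the remaining indices select a letter inside the gadget.\<close>

primrec letter :: "nat \<Rightarrow> nat list \<Rightarrow> rel" where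
  "letter 0 is = {(\<alpha>, \<beta>)}"
| "letter (Suc h) is = (if last is \<le> n then lift (last is) (letter h (butlast is))
     else if last is = n + 1 then lift 0 (letter h (butlast is)) else {(\<beta>, \<beta>)})"

lemma letter_T: "letter h is \<in> pmaps h"
proof (induction h arbitrary: "is")
  case (Suc h)
  have "\<beta> \<in> verts (Suc h)" "\<beta> \<in> verts (Suc h) - {\<alpha>}" using ab by auto
  then have "{(\<beta>, \<beta>)} \<in> pmaps (Suc h)" unfolding pmaps.simps by blast
  moreover have "lift i (letter h (butlast is)) \<in> pmaps (Suc h)" if "i \<le> n" for i
    using Suc that unfolding pmaps.simps by blast
  ultimately show ?case by (simp del: pmaps.simps)
qed simp

lemma path_block:
  assumes "(p, q) \<in> path (letter h) w" "e \<in> edges i" "j = i \<and> i \<le> n \<or> j = n + 1 \<and> i = 0"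
  shows "(emb i e p, emb i e q) \<in> path (letter (Suc h)) (map (\<lambda>is. is @ [j]) w)"
  using assms(1)
proof (induction w arbitrary: p)
  case (Cons x w)
  then obtain r where r: "(p, r) \<in> letter h x" "(r, q) \<in> path (letter h) w" by auto
  have "(emb i e p, emb i e r) \<in> lift i (letter h x)"
    using r(1) assms(2) unfolding lift_def by blast
  then have "(emb i e p, emb i e r) \<in> letter (Suc h) (x @ [j])"
    using assms(3) by auto
  then show ?case using Cons.IH[OF r(2)] by (auto intro: relcompI)
qed simp

lemma path_loop:
  "n + 1 < j \<Longrightarrow> (\<beta>, \<beta>) \<in> path (letter (Suc h)) (map (\<lambda>is. is @ [j]) w)"
  by (induction w) (auto intro: relcompI)

lemma path_v_word: "(\<alpha>, \<beta>) \<in> path (letter h) (v_word0 n m h)"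
proof (induction h)
  case (Suc h)
  let ?\<rho> = "letter (Suc h)"
  define B where "B j = map (\<lambda>is. is @ [j]) (v_word0 n m h)" for j
  have block: "(V a, V b) \<in> path ?\<rho> (B j)"
    if "(a, b) \<in> edges i" "j = i \<and> i \<le> n \<or> j = n + 1 \<and> i = 0" for a b i j
    using path_block[OF Suc that] by (simp add: B_def)
  have up: "(V 0, V k) \<in> path ?\<rho> (concat (map B [1..<k + 1]))" if "k \<le> n" for k
    using that
  proof (induction k)
    case (Suc k)
    have "(V k, V (Suc k)) \<in> path ?\<rho> (B (Suc k))"
      using Suc.prems by (intro block[of _ _ "Suc k"]) (simp_all add: edges_def)
    with Suc have "(V 0, V (Suc k)) \<in> path ?\<rho> (concat (map B [1..<k + 1]) @ B (Suc k))"
      unfolding path_append by (intro relcompI[of "V 0" "V k"]) (simp_all del: letter.simps)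
    moreover have "concat (map B [1..<Suc k + 1]) = concat (map B [1..<k + 1]) @ B (Suc k)" by simp
    ultimately show ?case by metis
  qed simp
  have down: "(V (n + k), V n) \<in> path ?\<rho> (concat (map B (rev [1..<k + 1])))" if "k \<le> n" for k
    using that
  proof (induction k)
    case (Suc k)
    have "(V (n + Suc k), V (n + k)) \<in> path ?\<rho> (B (Suc k))"
      using Suc.prems by (intro block[of _ _ "Suc k"]) (simp_all add: edges_def)
    with Suc have "(V (n + Suc k), V n) \<in> path ?\<rho> (B (Suc k) @ concat (map B (rev [1..<k + 1])))"
      unfolding path_append
      by (intro relcompI[of "V (n + Suc k)" "V (n + k)"]) (simp_all del: letter.simps)
    moreover have "concat (map B (rev [1..<Suc k + 1])) = B (Suc k) @ concat (map B (rev [1..<k + 1]))"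
      by simp
    ultimately show ?case by metis
  qed simp
  have "(V n, \<beta>) \<in> path ?\<rho> (B (n + 1))"
    by (intro block[of _ _ 0]) (simp_all add: edges_def)
  moreover have "(\<beta>, \<beta>) \<in> path ?\<rho> (concat (map B [n + 2..<2 * n + 1]))"
    unfolding B_def by (rule path_concat_loop, rule path_loop) auto
  ultimately have "(V n, \<beta>) \<in> path ?\<rho> (B (n + 1) @ concat (map B [n + 2..<2 * n + 1]))"
    by (auto intro: relcompI)
  moreover have "[n + 1..<2 * n + 1] = (n + 1) # [n + 2..<2 * n + 1]"
    using n3 by (simp add: upt_conv_Cons)
  ultimately have mid: "(V n, \<beta>) \<in> path ?\<rho> (concat (map B [n + 1..<2 * n + 1]))"
    by simp
  have "(\<beta>, V n) \<in> path ?\<rho> (concat (map B (rev [1..<n + 1])))"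
    using down[of n] by (simp add: mult_2)
  then have "(\<beta>, \<beta>) \<in> path ?\<rho> (concat (map B (rev [1..<n + 1])) @ concat (map B [n + 1..<2 * n + 1]))"
    using mid unfolding path_append by (rule relcompI)
  \<comment> \<open>The repeated factor labels a closed walk at \<beta>, so the exponent is
    arbitrary.\<close>
  note cycle = path_pow[OF this, of "2 * m - 1"]
  have "[1..<2 * n + 1] = [1..<n + 1] @ [n + 1..<2 * n + 1]"
    using upt_add_eq_append[of 1 "n + 1" n] by (simp add: mult_2)
  then have "(\<alpha>, \<beta>) \<in> path ?\<rho> (concat (map B [1..<2 * n + 1]))"
    using relcompI[OF up[of n] mid] by simp
  from relcompI[OF this cycle] have "(\<alpha>, \<beta>) \<in> path ?\<rho> (v_pattern n m B)"
    by (simp only: v_pattern_def path_append)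
  moreover have "v_word0 n m (Suc h) = v_pattern n m B" by (simp add: B_def[abs_def])
  ultimately show ?case by metis
qed simp

lemma v_word_not_idempotent:
  assumes "w = v_word n m (Suc h)"
  shows "word_eval (O) (letter (Suc h)) w \<noteq> word_eval (O) (letter (Suc h)) (word_pow w 2)"
proof
  assume eq: "word_eval (O) (letter (Suc h)) w = word_eval (O) (letter (Suc h)) (word_pow w 2)"
  define r where "r = path (letter (Suc h)) w"
  have r: "(\<alpha>, \<beta>) \<in> r" unfolding r_def assms v_word_eq by (rule path_v_word)
  then have ne: "w \<noteq> []" using ab by (auto simp: r_def)
  then have "r = r O r"
    using eq word_eval_path[OF ne, of "letter (Suc h)"] word_eval_path[of "w @ w" "letter (Suc h)"]
    by (simp add: r_def word_pow_def numeral_2_eq_2)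
  have "word_eval (O) (letter (Suc h)) u \<in> pmaps (Suc h)" if "u \<noteq> []" for u
    using that by (induction u rule: induct_list012) (simp_all add: letter_T pmaps_relcomp del: letter.simps pmaps.simps)
  from this[OF ne] have "r \<in> pmaps (Suc h)"
    using word_eval_path[OF ne, of "letter (Suc h)"] by (simp add: r_def)
  note sv = pmaps_sv[OF this] pmaps_inj[OF this]
  \<comment> \<open>Single-valuedness gives \<open>x = \<beta>\<close>; then \<alpha> and \<beta>
    have the same image, against injectivity.\<close>
  obtain x where "(\<alpha>, x) \<in> r" "(x, \<beta>) \<in> r" using r \<open>r = r O r\<close> by blast
  then have "(\<beta>, \<beta>) \<in> r" using r sv(1) by (metis single_valuedD)
  then have "\<alpha> = \<beta>" using r sv(2) by (metis converse_iff single_valuedD)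
  then show False using ab by simp
qed

end

section \<open>From words to terms, and the contradiction with a finite basis\<close>

fun word_trm :: "'v::countable list \<Rightarrow> trm" where
  "word_trm [] = undefined"
| "word_trm [x] = Var (to_nat x)"
| "word_trm (x # y # w) = Mul (Var (to_nat x)) (word_trm (y # w))"

lemma eval_word_trm:
  "w \<noteq> [] \<Longrightarrow> eval add mul \<phi> (word_trm w) = word_eval mul (\<lambda>x. \<phi> (to_nat x)) w"
  by (induction w rule: word_trm.induct) simp_all

theorem theorem4p2:
  fixes S :: "'a set" and add mul :: "'a \<Rightarrow> 'a \<Rightarrow> 'a"
  assumes "ai_semiring S add mul"
    and "\<exists>m h. m \<ge> 1 \<and> h \<ge> 1 \<and>
           (\<forall>n\<ge>2. semigroup_satisfies S mul (v_word n m h) (word_pow (v_word n m h) 2))"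
    and "\<forall>e. satisfies S add mul e \<longrightarrow> satisfies B21 nat_add (**) e"
  shows "\<not> (\<exists>\<Sigma>. finite \<Sigma> \<and> identity_basis S add mul \<Sigma>)"
proof
  assume "\<exists>\<Sigma>. finite \<Sigma> \<and> identity_basis S add mul \<Sigma>"
  then obtain \<Sigma> where fin: "finite \<Sigma>" and basis: "identity_basis S add mul \<Sigma>" by blast
  obtain m h where v: "\<And>n. n \<ge> 2 \<Longrightarrow>
      semigroup_satisfies S mul (v_word n m (Suc h)) (word_pow (v_word n m (Suc h)) 2)"
    using assms(2) by (metis One_nat_def Suc_le_D)
  \<comment> \<open>For empty \<open>\<Sigma>\<close> the value of \<open>Max\<close> is
    unspecified, but the bound below is then vacuous.\<close>
  define k where "k = Max ((\<lambda>(s, t). card (vars s) + card (vars t)) ` \<Sigma>)"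
  have k: "card (vars s) + card (vars t) \<le> k" if "(s, t) \<in> \<Sigma>" for s t
    using that fin unfolding k_def by (intro Max_ge) force+
  \<comment> \<open>Larger than the number of variables on either side of each basis identity, and
    at least 3 as the skeleton demands.\<close>
  define n where "n = k + 3"
  interpret skeleton n by unfold_locales (simp add: n_def)
  define w where "w = v_word n m (Suc h)"
  have "(\<alpha>, \<beta>) \<in> path (letter (Suc h)) w" unfolding w_def v_word_eq by (rule path_v_word)
  then have ne: "w \<noteq> []" "word_pow w 2 \<noteq> []"
    using ab by (auto simp: word_pow_def numeral_2_eq_2)
  have "satisfies S add mul (word_trm w, word_trm (word_pow w 2))"
    using v[of n, folded w_def] n3
    unfolding satisfies_def semigroup_satisfies_def fst_conv snd_conv
      eval_word_trm[OF ne(1)] eval_word_trm[OF ne(2)] by simp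
  then have "follows \<Sigma> (word_trm w) (word_trm (word_pow w 2))"
    using basis unfolding identity_basis_def by blast
  then have sat: "satisfies (pmaps (Suc h)) (\<inter>) (O) (word_trm w, word_trm (word_pow w 2))"
  proof (rule follows_sound)
    show "\<forall>e\<in>\<Sigma>. satisfies (pmaps (Suc h)) (\<inter>) (O) e"
    proof
      fix e assume e: "e \<in> \<Sigma>"
      obtain s t where st: "e = (s, t)" by (cases e)
      have "satisfies B21 nat_add (**) (s, t)"
        using basis assms(3) e unfolding st identity_basis_def by blast
      then show "satisfies (pmaps (Suc h)) (\<inter>) (O) e"
        using k[of s t] e unfolding st by (intro pmaps_satisfies) (simp_all add: n_def)
    qed
  qed (blast intro: pmaps_inter pmaps_relcomp)+
  \<comment> \<open>\<open>from_nat\<close> undoes the coding of index lists as variables, so each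
    letter of \<open>w\<close> is interpreted by its own map.\<close>
  have "eval (\<inter>) (O) (\<lambda>i. letter (Suc h) (from_nat i)) (word_trm w) =
      eval (\<inter>) (O) (\<lambda>i. letter (Suc h) (from_nat i)) (word_trm (word_pow w 2))"
    by (rule sat[unfolded satisfies_def fst_conv snd_conv, rule_format]) (rule letter_T)
  then have "word_eval (O) (letter (Suc h)) w = word_eval (O) (letter (Suc h)) (word_pow w 2)"
    unfolding eval_word_trm[OF ne(1)] eval_word_trm[OF ne(2)] from_nat_to_nat .
  then show False using v_word_not_idempotent[OF w_def] by blast
qed

end
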